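(* Let $\varepsilon>0$, let $k$ be a positive integer, let $n$ be an integer and let $b\leq(1-\varepsilon)\frac nk$. Then in the $(1:b)$ random-Breaker $k$-connectivity game played on $E(K_n)$, Maker has a strategy which is w.h.p.\ a winning strategy, and with it he wins within $(1+o(1))\frac{kn}2$ rounds.
   Context: The $(1:b)$ random-Breaker game on the board $E(K_n)$: Maker and Breaker alternately claim previously unclaimed edges of $K_n$, Breaker moving first. In each round Breaker claims $b$ edges chosen uniformly at random among all unclaimed edges, and then Maker claims one unclaimed edge of his choice. In the $k$-connectivity game, Maker wins if his graph is a $k$-vertex-connected spanning subgraph of $K_n$. "W.h.p." means with probability tending to $1$ as $n\to\infty$.
   Formalization: The formal theorem takes k ≥ 2 instead of every positive integer k: for k = 1 the claim is false, since a connected spanning graph has at least n−1 edges and Maker claims one edge per round, so he cannot win within (1+o(1))n/2 rounds for any b. *)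

theory Defs
  imports "HOL-Probability.Probability"
begin

definition complete_edges :: "nat \<Rightarrow> nat set set" where
  "complete_edges n = {e. e \<subseteq> {..<n} \<and> card e = 2}"

definition graph_connected :: "'a set \<Rightarrow> 'a set set \<Rightarrow> bool" where
  "graph_connected V E \<longleftrightarrow>
     (\<forall>u\<in>V. \<forall>v\<in>V. (u, v) \<in> {(x, y). x \<in> V \<and> y \<in> V \<and> {x, y} \<in> E}\<^sup>*)"

text \<open>The edge set is not restricted after deleting \<open>X\<close>, since \<^const>\<open>graph_connected\<close> ignores
  edges that leave its vertex set.\<close>

definition vertex_connected :: "nat \<Rightarrow> 'a set \<Rightarrow> 'a set set \<Rightarrow> bool" where
  "vertex_connected k V E \<longleftrightarrow>
     card V > k \<and> (\<forall>X. X \<subseteq> V \<and> card X < k \<longrightarrow> graph_connected (V - X) E)"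

text \<open>A history lists the completed rounds chronologically, each as Breaker's set of edges together
  with Maker's reply; the reply is \<^const>\<open>None\<close> iff Breaker has just exhausted the board.\<close>

type_synonym history = "(nat set set \<times> nat set option) list"

definition breaker_edges :: "history \<Rightarrow> nat set set" where
  "breaker_edges h = (\<Union>(B, m)\<in>set h. B)"

definition maker_edges :: "history \<Rightarrow> nat set set" where
  "maker_edges h = (\<Union>(B, m)\<in>set h. set_option m)"

definition unclaimed :: "nat \<Rightarrow> history \<Rightarrow> nat set set" where
  "unclaimed n h = complete_edges n - (breaker_edges h \<union> maker_edges h)"

text \<open>If fewer than \<open>b\<close> edges are unclaimed, then Breaker claims all of them.\<close>

definition breaker_move :: "nat \<Rightarrow> nat \<Rightarrow> history \<Rightarrow> nat set set pmf" where
  "breaker_move n b h =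
     pmf_of_set {B. B \<subseteq> unclaimed n h \<and> card B = min b (card (unclaimed n h))}"

text \<open>\<open>S h B\<close> is Maker's reply when Breaker has played \<open>B\<close> after the history \<open>h\<close>.\<close>

type_synonym strategy = "history \<Rightarrow> nat set set \<Rightarrow> nat set"

definition maker_strategy :: "nat \<Rightarrow> strategy \<Rightarrow> bool" where
  "maker_strategy n S \<longleftrightarrow>
     (\<forall>h B. B \<subseteq> unclaimed n h \<and> unclaimed n h - B \<noteq> {} \<longrightarrow> S h B \<in> unclaimed n h - B)"

definition play_round :: "nat \<Rightarrow> nat \<Rightarrow> strategy \<Rightarrow> history \<Rightarrow> history pmf" where
  "play_round n b S h =
     map_pmf (\<lambda>B. h @ [(B, if unclaimed n h - B = {} then None else Some (S h B))])
       (breaker_move n b h)"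

primrec play_rounds :: "nat \<Rightarrow> nat \<Rightarrow> strategy \<Rightarrow> nat \<Rightarrow> history pmf" where
  "play_rounds n b S 0 = return_pmf []"
| "play_rounds n b S (Suc t) =
     bind_pmf (play_rounds n b S t)
       (\<lambda>h. if unclaimed n h = {} then return_pmf h else play_round n b S h)"

text \<open>Every round claims at least one edge (also for \<open>b = 0\<close>), so \<open>n choose 2\<close> rounds always
  exhaust the board.\<close>

definition random_breaker_game :: "nat \<Rightarrow> nat \<Rightarrow> strategy \<Rightarrow> history pmf" where
  "random_breaker_game n b S = play_rounds n b S (n choose 2)"

text \<open>Pitfall: against biases up to \<open>(1 - \<epsilon>) n / k\<close>, and within \<open>(1 + o(1)) k n / 2\<close> rounds, Maker can
  win this game only for \<open>k \<ge> 2\<close>. A connected spanning graph has at least \<open>n - 1\<close> edges, whereas for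
  \<open>k = 1\<close> he would have only about \<open>n / 2\<close> rounds; moreover, for \<open>b\<close> close to \<open>(1 - \<epsilon>) n\<close> with
  \<open>\<epsilon> < 1 / 2\<close> he claims only about \<open>n / (2 (1 - \<epsilon>)) < n - 1\<close> edges in the entire game.\<close>

definition maker_wins :: "nat \<Rightarrow> nat \<Rightarrow> history \<Rightarrow> bool" where
  "maker_wins n k h \<longleftrightarrow> vertex_connected k {..<n} (maker_edges h)"

definition maker_wins_within :: "nat \<Rightarrow> nat \<Rightarrow> real \<Rightarrow> history \<Rightarrow> bool" where
  "maker_wins_within n k r h \<longleftrightarrow>
     (\<exists>t. t \<le> length h \<and> real t \<le> r \<and> maker_wins n k (take t h))"

end

theory Submission
  imports Defs "HOL-Real_Asymp.Real_Asymp"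
begin

text \<open>
  Maker first claims all edges between \<open>k\<close> hubs and about \<open>n\<^sup>1\<^sup>/\<^sup>4\<close> further vertices; Breaker has no time to
  interfere, and the resulting core \<open>C\<close> stays connected after deleting fewer than \<open>k\<close> vertices. It then
  suffices that every other vertex \<open>v\<close> has a fan into \<open>C\<close>: after deleting fewer than \<open>k\<close> vertices other
  than \<open>v\<close>, it still reaches \<open>C\<close>. Joining \<open>v\<close> to \<open>k\<close> core vertices gives a fan but costs \<open>k\<close> edges, so
  this is done for only \<open>o(n)\<close> vertices. The others are treated in batches of \<open>2L\<close> vertices
  \<open>a\<^sub>0, \<dots>, a\<^bsub>L-1\<^esub>, b\<^sub>0, \<dots>, b\<^bsub>L-1\<^esub>\<close>, which are made into a strip in which \<open>a\<^sub>i\<close> is joined to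
  \<open>b\<^sub>i, \<dots>, b\<^bsub>i+k-1\<^esub>\<close> and only the \<open>O(k)\<close> vertices at the two ends are joined to \<open>C\<close>; this costs
  \<open>(1 + o(1)) k / 2\<close> edges per vertex.

  With probability tending to 1, the edges not taken by Breaker after \<open>(1 + \<delta>) k n / 2\<close> rounds are so
  dense that any \<open>\<gamma> n\<close> vertices span a free complete bipartite graph with parts of size \<open>L\<close>. A task of
  boundedly many edges is spoiled by Breaker with probability \<open>O(1 / n)\<close> only, so that the expected
  number of spoiled tasks is bounded.
\<close>

section \<open>Fans and strips\<close>

text \<open>Adjacency after deleting \<open>X\<close>. No vertex set is fixed; when all edges lie
  inside \<open>V\<close>, this is the adjacency that \<open>graph_connected\<close> uses on
  \<open>V - X\<close>.\<close>

definition avoiding :: "'a set set \<Rightarrow> 'a set \<Rightarrow> ('a \<times> 'a) set" where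
  "avoiding H X = {(x, y). x \<notin> X \<and> y \<notin> X \<and> {x, y} \<in> H}"

text \<open>For \<open>v\<close> outside \<open>C\<close> this amounts, by Menger's theorem, to
  \<open>k\<close> paths from \<open>v\<close> to \<open>C\<close> that pairwise share only
  \<open>v\<close>. The deletion form is the one that \<open>vertex_connected\<close> asks
  for.\<close>

definition fan :: "nat \<Rightarrow> 'a set \<Rightarrow> 'a set set \<Rightarrow> 'a \<Rightarrow> bool" where
  "fan k C H v \<longleftrightarrow>
     (\<forall>X. finite X \<and> card X < k \<and> v \<notin> X \<longrightarrow> (\<exists>c\<in>C - X. (v, c) \<in> (avoiding H X)\<^sup>*))"

definition cross :: "'a set \<Rightarrow> 'a set \<Rightarrow> 'a set set" where
  "cross A B = (\<lambda>(x, y). {x, y}) ` (A \<times> B)"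

lemma sym_avoiding: "sym (avoiding H X)"
  by (auto simp: avoiding_def sym_def insert_commute)

lemma avoiding_mono: "H \<subseteq> H' \<Longrightarrow> avoiding H X \<subseteq> avoiding H' X"
  by (auto simp: avoiding_def)

lemma fan_mono:
  assumes "fan k C H v" "H \<subseteq> H'"
  shows "fan k C H' v"
proof -
  have "(avoiding H X)\<^sup>* \<subseteq> (avoiding H' X)\<^sup>*" for X
    by (intro rtrancl_mono avoiding_mono assms)
  then show ?thesis using assms(1) unfolding fan_def by blast
qed

text \<open>After deleting \<open>X\<close>, every surviving vertex reaches a surviving core vertex,
  and these reach each other.\<close>

lemma vertex_connected_if_fan:
  assumes "finite V" "k < card V" "C \<subseteq> V" "\<Union>E \<subseteq> V"
    and fan: "\<And>v. v \<in> V - C \<Longrightarrow> fan k C E v"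
    and core: "\<And>X c d. \<lbrakk>finite X; card X < k; c \<in> C - X; d \<in> C - X\<rbrakk> \<Longrightarrow> (c, d) \<in> (avoiding E X)\<^sup>*"
  shows "vertex_connected k V E"
  unfolding vertex_connected_def graph_connected_def
proof (intro conjI allI impI ballI assms)
  fix X u v assume X: "X \<subseteq> V \<and> card X < k" and u: "u \<in> V - X" and v: "v \<in> V - X"
  have fX: "finite X" using X \<open>finite V\<close> finite_subset by blast
  have eq: "{(x, y). x \<in> V - X \<and> y \<in> V - X \<and> {x, y} \<in> E} = avoiding E X"
    using assms(4) by (auto simp: avoiding_def)
  have to_core: "\<exists>c\<in>C - X. (w, c) \<in> (avoiding E X)\<^sup>*" if "w \<in> V - X" for w
  proof (cases "w \<in> C")
    case True
    then show ?thesis using that by blast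
  next
    case False
    then show ?thesis using fan[of w] that X fX unfolding fan_def by blast
  qed
  obtain c where c: "c \<in> C - X" "(u, c) \<in> (avoiding E X)\<^sup>*" using to_core u by blast
  obtain d where d: "d \<in> C - X" "(v, d) \<in> (avoiding E X)\<^sup>*" using to_core v by blast
  have "(d, v) \<in> (avoiding E X)\<^sup>*"
    using d(2) by (meson sym_avoiding sym_rtrancl symD)
  then show "(u, v) \<in> {(x, y). x \<in> V - X \<and> y \<in> V - X \<and> {x, y} \<in> E}\<^sup>*"
    unfolding eq using c d core[OF fX _ c(1) d(1)] X by (meson rtrancl_trans)
qed

text \<open>Fewer than \<open>k\<close> deletions leave some \<open>x\<close> in \<open>D\<close>
  and some \<open>y\<close> in \<open>R\<close>; every survivor reaches \<open>x\<close> directly or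
  through \<open>y\<close>.\<close>

lemma cross_connected_avoiding:
  assumes "finite D" "finite R" "k \<le> card D" "k \<le> card R" "finite X" "card X < k"
    and E: "cross D R \<subseteq> E" and c: "c \<in> (D \<union> R) - X" and d: "d \<in> (D \<union> R) - X"
  shows "(c, d) \<in> (avoiding E X)\<^sup>*"
proof -
  have "\<not> D \<subseteq> X" "\<not> R \<subseteq> X"
    using assms(1-6) by (meson card_mono leD le_trans)+
  then obtain x y where x: "x \<in> D" "x \<notin> X" and y: "y \<in> R" "y \<notin> X" by blast
  have adj: "(p, q) \<in> avoiding E X" if "p \<in> D - X" "q \<in> R - X" for p q
    using that E by (auto simp: avoiding_def cross_def)
  have adj': "(q, p) \<in> avoiding E X" if "p \<in> D - X" "q \<in> R - X" for p q
    using adj[OF that] sym_avoiding by (metis symD)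
  have to_x: "(z, x) \<in> (avoiding E X)\<^sup>*" if "z \<in> (D \<union> R) - X" for z
  proof (cases "z \<in> D")
    case True
    then have "(z, y) \<in> avoiding E X" "(y, x) \<in> avoiding E X"
      using adj adj' that x y by auto
    then show ?thesis by (meson r_into_rtrancl rtrancl_trans)
  next
    case False
    then show ?thesis using adj' that x by auto
  qed
  show ?thesis using to_x[OF c] to_x[OF d]
    by (meson sym_avoiding sym_rtrancl symD rtrancl_trans)
qed

lemma finite_cross: "finite A \<Longrightarrow> finite B \<Longrightarrow> finite (cross A B)"
  by (simp add: cross_def)

lemma card_cross_le: "finite A \<Longrightarrow> finite B \<Longrightarrow> card (cross A B) \<le> card A * card B"
  unfolding cross_def by (metis card_cartesian_product card_image_le finite_cartesian_product)

lemma card_cross: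
  assumes "A \<inter> B = {}"
  shows "card (cross A B) = card A * card B"
proof -
  have "inj_on (\<lambda>(x, y). {x, y}) (A \<times> B)"
    using assms by (auto simp: inj_on_def doubleton_eq_iff)
  then show ?thesis by (simp add: cross_def card_image card_cartesian_product)
qed

lemma cross_complete:
  "A \<subseteq> {..<n} \<Longrightarrow> B \<subseteq> {..<n} \<Longrightarrow> A \<inter> B = {} \<Longrightarrow> cross A B \<subseteq> complete_edges n"
  by (auto simp: cross_def complete_edges_def card_insert_if)

lemma fan_star:
  assumes "N \<subseteq> C" "k \<le> card N" "cross {v} N \<subseteq> H"
  shows "fan k C H v"
  unfolding fan_def
proof (intro allI impI)
  fix X assume X: "finite X \<and> card X < k \<and> v \<notin> X"
  have "\<not> N \<subseteq> X" using X assms(2) by (meson card_mono leD le_trans)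
  then obtain c where c: "c \<in> N" "c \<notin> X" by blast
  have "(v, c) \<in> avoiding H X" using c X assms(3) by (auto simp: avoiding_def cross_def)
  then show "\<exists>c\<in>C - X. (v, c) \<in> (avoiding H X)\<^sup>*" using c assms(1) by blast
qed

text \<open>In the first part \<open>j\<close> is the offset of the partner. The vertices joined to
  the core are those with fewer than \<open>k\<close> partners inside the strip: \<open>a i\<close>
  with \<open>L < i + k\<close> and \<open>b j\<close> with \<open>j + 1 < k\<close>.\<close>

definition strip :: "nat \<Rightarrow> nat \<Rightarrow> (nat \<Rightarrow> 'a) \<Rightarrow> (nat \<Rightarrow> 'a) \<Rightarrow> ('a \<Rightarrow> 'a set) \<Rightarrow> 'a set set" where
  "strip k L a b N =
     (\<lambda>(i, j). {a i, b (i + j)}) ` {(i, j). i < L \<and> j < k \<and> i + j < L}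
     \<union> (\<Union>i\<in>{i. i < L \<and> L < i + k}. cross {a i} (N (a i)))
     \<union> (\<Union>j\<in>{j. j < L \<and> j + 1 < k}. cross {b j} (N (b j)))"

text \<open>If the component of \<open>v\<close> after deleting \<open>X\<close> avoids the ends of the strip, then \<open>X\<close> must contain
  \<open>k - 1\<close> vertices on either side of it, which is too many because \<open>2 (k - 1) \<ge> k\<close>.\<close>

lemma fan_strip:
  assumes k: "k \<ge> 2"
    and inj: "inj_on a {..<L}" "inj_on b {..<L}" "a ` {..<L} \<inter> b ` {..<L} = {}"
    and N: "\<And>x. x \<in> a ` {..<L} \<union> b ` {..<L} \<Longrightarrow> N x \<subseteq> C \<and> card (N x) = k"
    and v: "v \<in> a ` {..<L} \<union> b ` {..<L}"
  shows "fan k C (strip k L a b N) v"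
  unfolding fan_def
proof (intro allI impI, rule ccontr)
  fix X assume X: "finite X \<and> card X < k \<and> v \<notin> X"
  let ?H = "strip k L a b N"
  let ?R = "avoiding ?H X"
  assume no: "\<not> (\<exists>c\<in>C - X. (v, c) \<in> ?R\<^sup>*)"
  define A where "A = {x. (v, x) \<in> ?R\<^sup>*}"
  have AX: "x \<notin> X" if "x \<in> A" for x
  proof -
    have "(v, x) \<in> ?R\<^sup>*" using that by (simp add: A_def)
    then show ?thesis by (cases rule: rtranclE) (use X in \<open>auto simp: avoiding_def\<close>)
  qed
  have step: "y \<in> A \<or> y \<in> X" if "x \<in> A" "{x, y} \<in> ?H" for x y
    using that AX[OF that(1)] by (auto simp: A_def avoiding_def intro: rtrancl_into_rtrancl)
  define I where "I = {i. i < L \<and> a i \<in> A}"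
  define J where "J = {j. j < L \<and> b j \<in> A}"
  \<comment> \<open>A vertex of \<open>A\<close> joined to \<open>k\<close> core vertices would
    reach one outside \<open>X\<close>. Hence \<open>A\<close> contains no end vertex, and each
    strip vertex in it has all \<open>k\<close> partners.\<close>
  have noend: "\<not> cross {x} (N x) \<subseteq> ?H" if "x \<in> A" "x \<in> a ` {..<L} \<union> b ` {..<L}" for x
  proof
    assume sub: "cross {x} (N x) \<subseteq> ?H"
    have "\<not> N x \<subseteq> X" using N[OF that(2)] X by (metis card_mono leD)
    then obtain c where c: "c \<in> N x" "c \<notin> X" by blast
    then have "c \<in> A" using step[OF that(1), of c] sub by (auto simp: cross_def)
    then show False using no c N[OF that(2)] by (auto simp: A_def)
  qed
  have Iend: "i + k \<le> L" if "i \<in> I" for i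
  proof (rule ccontr)
    assume "\<not> i + k \<le> L"
    then have "cross {a i} (N (a i)) \<subseteq> ?H" using that by (auto simp: strip_def I_def)
    then show False using noend[of "a i"] that by (auto simp: I_def)
  qed
  have Jend: "k \<le> j + 1" if "j \<in> J" for j
  proof (rule ccontr)
    assume "\<not> k \<le> j + 1"
    then have "cross {b j} (N (b j)) \<subseteq> ?H" using that by (auto simp: strip_def J_def)
    then show False using noend[of "b j"] that by (auto simp: J_def)
  qed
  have edge: "{a i, b j} \<in> ?H" if "i \<le> j" "j < i + k" "j < L" for i j
  proof -
    have "(i, j - i) \<in> {(i, j). i < L \<and> j < k \<and> i + j < L}" using that by auto
    then have "(\<lambda>(i, j). {a i, b (i + j)}) (i, j - i) \<in> ?H" unfolding strip_def by blast
    then show ?thesis using that by simp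
  qed
  have IJ: "j \<in> J \<or> b j \<in> X" if "i \<in> I" "i \<le> j" "j < i + k" for i j
    using step[of "a i" "b j"] edge[of i j] that Iend[of i] by (auto simp: I_def J_def)
  have JI: "i \<in> I \<or> a i \<in> X" if "j \<in> J" "i \<le> j" "j < i + k" for i j
    using step[of "b j" "a i"] edge[of i j] that by (auto simp: I_def J_def insert_commute)
  \<comment> \<open>Otherwise all \<open>k\<close> partners of \<open>a i\<close> would be
    deleted.\<close>
  have exJ: "\<exists>j\<in>J. i \<le> j \<and> j < i + k" if "i \<in> I" for i
  proof (rule ccontr)
    assume "\<not> ?thesis"
    then have "b ` {i..<i + k} \<subseteq> X" using IJ[OF that] by force
    then have "card (b ` {i..<i + k}) \<le> card X" using X by (simp add: card_mono)
    moreover have "card (b ` {i..<i + k}) = k"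
      using Iend[OF that] by (subst card_image) (auto intro: inj_on_subset[OF inj(2)])
    ultimately show False using X by simp
  qed
  have exI: "\<exists>i\<in>I. i \<le> j \<and> j < i + k" if "j \<in> J" for j
  proof (rule ccontr)
    assume "\<not> ?thesis"
    then have "a i \<in> X" if "i \<in> {j + 1 - k..<j + 1}" for i
      using JI[OF \<open>j \<in> J\<close>, of i] that by force
    then have "a ` {j + 1 - k..<j + 1} \<subseteq> X" by blast
    then have "card (a ` {j + 1 - k..<j + 1}) \<le> card X" using X by (simp add: card_mono)
    moreover have "card (a ` {j + 1 - k..<j + 1}) = k"
      using Jend[OF that] that
      by (subst card_image) (auto intro!: inj_on_subset[OF inj(1)] simp: J_def)
    ultimately show False using X by simp
  qed
  have "v \<in> A" by (simp add: A_def)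
  then have "I \<noteq> {} \<or> J \<noteq> {}" using v by (auto simp: I_def J_def)
  then have ne: "I \<noteq> {}" "J \<noteq> {}" using exI exJ by blast+
  have fin: "finite I" "finite J" by (auto simp: I_def J_def)
  define i1 where "i1 = Max I"
  define j1 where "j1 = Max J"
  define i0 where "i0 = Min I"
  define j0 where "j0 = Min J"
  have in1: "i1 \<in> I" "j1 \<in> J" "i0 \<in> I" "j0 \<in> J"
    using ne fin by (auto simp: i1_def j1_def i0_def j0_def)
  have bd: "i0 \<le> i" "i \<le> i1" if "i \<in> I" for i using that fin by (auto simp: i1_def i0_def)
  have bd': "j0 \<le> j" "j \<le> j1" if "j \<in> J" for j using that fin by (auto simp: j1_def j0_def)
  have o1: "i1 \<le> j1" using exJ[OF in1(1)] bd' by (meson le_trans)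
  have o2: "j1 < i1 + k" using exI[OF in1(2)] bd by (meson add_le_mono1 less_le_trans)
  have o3: "i0 \<le> j0" using exI[OF in1(4)] bd by (meson le_trans)
  have o4: "j0 < i0 + k" using exJ[OF in1(3)] bd' by (meson le_less_trans)
  \<comment> \<open>Partners of an extreme vertex that lie beyond the extremes of the opposite side
    must be deleted. At the top these are \<open>i1 + k - 1 - j1\<close> vertices \<open>b j\<close>
    and \<open>j1 - i1\<close> vertices \<open>a i\<close>, at the bottom \<open>j0 - i0\<close> and
    \<open>i0 + k - 1 - j0\<close>: together \<open>k - 1\<close> at either end.\<close>
  have Xs: "b ` {j1 + 1..<i1 + k} \<subseteq> X" "a ` {i1 + 1..j1} \<subseteq> X"
    "b ` {i0..<j0} \<subseteq> X" "a ` {j0 + 1 - k..<i0} \<subseteq> X"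
  proof -
    have "b j \<in> X" if "j1 + 1 \<le> j" "j < i1 + k" for j
      using IJ[OF in1(1), of j] o1 bd'(2)[of j] that by linarith
    then show "b ` {j1 + 1..<i1 + k} \<subseteq> X" by auto
    have "a i \<in> X" if "i1 + 1 \<le> i" "i \<le> j1" for i
      using JI[OF in1(2), of i] o2 bd(2)[of i] that by linarith
    then show "a ` {i1 + 1..j1} \<subseteq> X" by auto
    have "b j \<in> X" if "i0 \<le> j" "j < j0" for j
      using IJ[OF in1(3), of j] o4 bd'(1)[of j] that by linarith
    then show "b ` {i0..<j0} \<subseteq> X" by auto
    have "a i \<in> X" if "j0 + 1 - k \<le> i" "i < i0" for i
      using JI[OF in1(4), of i] o3 bd(1)[of i] Jend[OF in1(4)] that by linarith
    then show "a ` {j0 + 1 - k..<i0} \<subseteq> X" by auto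
  qed
  let ?B = "{i0..<j0} \<union> {j1 + 1..<i1 + k}" and ?A = "{j0 + 1 - k..<i0} \<union> {i1 + 1..j1}"
  have L: "?A \<subseteq> {..<L}" "?B \<subseteq> {..<L}"
    using Iend[OF in1(1)] in1 by (auto simp: I_def J_def)
  have "card (a ` ?A \<union> b ` ?B) = card (a ` ?A) + card (b ` ?B)"
  proof (rule card_Un_disjoint)
    show "a ` ?A \<inter> b ` ?B = {}" using image_mono[OF L(1), of a] image_mono[OF L(2), of b] inj(3) by blast
  qed auto
  also have "\<dots> = card ?A + card ?B"
    using L by (simp add: card_image inj_on_subset[OF inj(1)] inj_on_subset[OF inj(2)])
  also have "card ?A = (i0 - (j0 + 1 - k)) + (j1 - i1)"
    using bd[OF in1(1)] by (subst card_Un_disjoint) auto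
  also have "card ?B = (j0 - i0) + (i1 + k - (j1 + 1))"
    using bd'[OF in1(2)] by (subst card_Un_disjoint) auto
  finally have "card (a ` ?A \<union> b ` ?B) = 2 * (k - 1)"
    using o1 o2 o3 o4 Jend[OF in1(4)] k by auto
  moreover have "card (a ` ?A \<union> b ` ?B) \<le> card X"
    using Xs X by (intro card_mono) (auto simp: image_Un)
  ultimately show False using X k by linarith
qed

text \<open>The offsets give at most \<open>k * L\<close> edges; at either end at most
  \<open>k\<close> vertices send \<open>k\<close> edges each to the core.\<close>

lemma card_strip_le:
  assumes N: "\<And>x. x \<in> a ` {..<L} \<union> b ` {..<L} \<Longrightarrow> finite (N x) \<and> card (N x) = k"
  shows "card (strip k L a b N) \<le> k * L + 2 * k * k"
proof -
  let ?S = "{(i, j). i < L \<and> j < k \<and> i + j < L}"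
  let ?E = "(\<lambda>(i, j). {a i, b (i + j)}) ` ?S"
  let ?F = "\<Union>i\<in>{i. i < L \<and> L < i + k}. cross {a i} (N (a i))"
  let ?G = "\<Union>j\<in>{j. j < L \<and> j + 1 < k}. cross {b j} (N (b j))"
  have sub: "?S \<subseteq> {..<L} \<times> {..<k}" by auto
  have finS: "finite ?S" by (rule finite_subset[OF sub]) simp
  have "card ?E \<le> card ?S" by (rule card_image_le[OF finS])
  also have "\<dots> \<le> card ({..<L} \<times> {..<k})" by (rule card_mono[OF _ sub]) simp
  finally have E: "card ?E \<le> k * L" by (simp add: card_cartesian_product mult.commute)
  have "card ?F \<le> (\<Sum>i\<in>{i. i < L \<and> L < i + k}. card (cross {a i} (N (a i))))"
    by (rule card_UN_le) simp
  also have "\<dots> \<le> (\<Sum>i\<in>{i. i < L \<and> L < i + k}. k)"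
  proof (intro sum_mono)
    fix i assume "i \<in> {i. i < L \<and> L < i + k}"
    then have "finite (N (a i)) \<and> card (N (a i)) = k" by (intro N) auto
    then show "card (cross {a i} (N (a i))) \<le> k" using card_cross_le[of "{a i}" "N (a i)"] by auto
  qed
  also have "\<dots> = card {i. i < L \<and> L < i + k} * k" by simp
  also have "\<dots> \<le> card {L - k..<L} * k" by (intro mult_right_mono card_mono) auto
  also have "\<dots> \<le> k * k" by (intro mult_right_mono) auto
  finally have F: "card ?F \<le> k * k" .
  have "card ?G \<le> (\<Sum>j\<in>{j. j < L \<and> j + 1 < k}. card (cross {b j} (N (b j))))"
    by (rule card_UN_le) simp
  also have "\<dots> \<le> (\<Sum>j\<in>{j. j < L \<and> j + 1 < k}. k)"
  proof (intro sum_mono)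
    fix i assume "i \<in> {j. j < L \<and> j + 1 < k}"
    then have "finite (N (b i)) \<and> card (N (b i)) = k" by (intro N) auto
    then show "card (cross {b i} (N (b i))) \<le> k" using card_cross_le[of "{b i}" "N (b i)"] by auto
  qed
  also have "\<dots> = card {j. j < L \<and> j + 1 < k} * k" by simp
  also have "\<dots> \<le> card {..<k} * k" by (intro mult_right_mono card_mono) auto
  finally have G: "card ?G \<le> k * k" by simp
  have "card (strip k L a b N) \<le> card ?E + card ?F + card ?G"
    unfolding strip_def by (meson add_le_mono1 card_Un_le le_trans)
  then show "card (strip k L a b N) \<le> k * L + 2 * k * k" using E F G by simp
qed

lemma strip_subset:
  "strip k L a b N \<subseteq> cross (a ` {..<L}) (b ` {..<L}) \<union>
     (\<Union>x\<in>a ` {..<L} \<union> b ` {..<L}. cross {x} (N x))"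
  by (auto simp: strip_def cross_def)

lemma greedy_biclique:
  fixes \<alpha> \<beta> :: real
  assumes dense: "\<And>A' U'. \<lbrakk>A' \<subseteq> A; U' \<subseteq> U; card A' = K; \<beta> \<le> real (card U')\<rbrakk> \<Longrightarrow>
       \<exists>a\<in>A'. \<alpha> * card U' \<le> card {u \<in> U'. r a u}"
    and fin: "finite A" "finite U" and "K + i \<le> card A + 1" and \<alpha>: "0 < \<alpha>" "\<alpha> \<le> 1"
    and big: "\<beta> \<le> \<alpha> ^ i * card U"
  shows "\<exists>S U'. S \<subseteq> A \<and> card S = i \<and> U' \<subseteq> U \<and> \<alpha> ^ i * card U \<le> card U' \<and> (\<forall>a\<in>S. \<forall>u\<in>U'. r a u)"
  using assms(4) big
proof (induction i)
  case 0
  show ?case by (intro exI[of _ "{}"] exI[of _ U]) auto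
next
  case (Suc i)
  have "\<alpha> ^ Suc i * card U \<le> \<alpha> ^ i * card U"
    using \<alpha> by (intro mult_right_mono power_decreasing) auto
  then have \<beta>: "\<beta> \<le> \<alpha> ^ i * card U" using Suc.prems by linarith
  then obtain S U' where S: "S \<subseteq> A" "card S = i" and U': "U' \<subseteq> U" "\<alpha> ^ i * card U \<le> card U'"
    and r: "\<forall>a\<in>S. \<forall>u\<in>U'. r a u"
    using Suc by auto
  have finS: "finite S" using S fin finite_subset by blast
  have "K \<le> card (A - S)" using S finS Suc.prems by (simp add: card_Diff_subset)
  then obtain A' where A': "A' \<subseteq> A - S" "card A' = K" by (meson obtain_subset_with_card_n)
  then obtain a where a: "a \<in> A'" "\<alpha> * card U' \<le> card {u \<in> U'. r a u}"
    using dense[of A' U'] U' \<beta> by auto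
  have "\<alpha> ^ Suc i * card U = \<alpha> * (\<alpha> ^ i * card U)" by simp
  also have "\<dots> \<le> \<alpha> * card U'" using U' \<alpha> by (intro mult_left_mono) auto
  finally have "\<alpha> ^ Suc i * card U \<le> card {u \<in> U'. r a u}" using a by linarith
  then show ?case
    using S U' r a A' finS
    by (intro exI[of _ "insert a S"] exI[of _ "{u \<in> U'. r a u}"]) (auto simp: subset_iff)
qed

section \<open>Maker's strategy\<close>

lemma finite_complete_edges: "finite (complete_edges n)"
  by (rule finite_subset[of _ "Pow {..<n}"]) (auto simp: complete_edges_def)

lemma card_complete_edges: "card (complete_edges n) = n choose 2"
  unfolding complete_edges_def by (subst n_subsets) auto

lemma finite_unclaimed: "finite (unclaimed n h)"
  by (simp add: unclaimed_def finite_complete_edges)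

lemma maker_edges_Nil [simp]: "maker_edges [] = {}"
  and breaker_edges_Nil [simp]: "breaker_edges [] = {}"
  and maker_edges_snoc [simp]: "maker_edges (h @ [(B, Some e)]) = insert e (maker_edges h)"
  and breaker_edges_snoc [simp]: "breaker_edges (h @ [(B, m)]) = breaker_edges h \<union> B"
  by (auto simp: maker_edges_def breaker_edges_def)

lemma unclaimed_snoc: "unclaimed n (h @ [(B, Some e)]) = unclaimed n h - B - {e}"
  by (auto simp: unclaimed_def)

text \<open>The histories in which Breaker always takes exactly \<open>b\<close> edges and leaves
  one for Maker, so that every reply is a \<open>Some\<close>.\<close>

inductive play :: "nat \<Rightarrow> nat \<Rightarrow> strategy \<Rightarrow> history \<Rightarrow> bool" for n b S where
  Nil: "play n b S []"
| snoc: "\<lbrakk>play n b S h; B \<subseteq> unclaimed n h; card B = b; unclaimed n h - B \<noteq> {}\<rbrakk> \<Longrightarrow>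
    play n b S (h @ [(B, Some (S h B))])"

lemma play_subset:
  assumes "play n b S h" "maker_strategy n S"
  shows "maker_edges h \<subseteq> complete_edges n"
  using assms(1)
proof (induction rule: play.induct)
  case (snoc h B)
  then have "S h B \<in> unclaimed n h - B"
    using assms(2) unfolding maker_strategy_def by blast
  then show ?case using snoc by (auto simp: unclaimed_def)
qed simp

text \<open>A state \<open>(Y, P, H, x)\<close> consists of the vertices \<open>Y\<close> that still lack a fan into the core, the
  current task \<open>(P, H)\<close> of claiming all edges of \<open>H\<close> in order to remove \<open>P\<close> from \<open>Y\<close>, and the penalty
  \<open>x\<close> for the tasks spoiled by Breaker. Only the initial task of building the core has \<open>P = {}\<close> and
  \<open>H \<noteq> {}\<close>; spoiling it is penalised by \<open>n\<close>.\<close>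

type_synonym state = "nat set \<times> nat set \<times> nat set set \<times> nat"

text \<open>\<open>w\<close> is the edge budget as a function of the number of vertices still
  lacking a fan: an admissible task must cost no more than the drop of \<open>w\<close> that it
  causes. \<open>s\<close> bounds the size of a task.\<close>

locale task_strategy =
  fixes n b k s :: nat and C :: "nat set" and core :: "nat set set" and w :: "nat \<Rightarrow> real"
  assumes core_complete: "core \<subseteq> complete_edges n"
    and w_nonneg: "\<And>z. 0 \<le> w z"
begin

definition admissible :: "nat set \<Rightarrow> nat set \<Rightarrow> nat set set \<Rightarrow> bool" where
  "admissible Y P H \<longleftrightarrow> P \<noteq> {} \<and> P \<subseteq> Y \<and> H \<noteq> {} \<and> H \<subseteq> complete_edges n \<and> card H \<le> s \<and>
     (\<forall>v\<in>P. fan k C H v) \<and> card H + w (card (Y - P)) \<le> w (card Y)"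

text \<open>The default is the idle task. Its empty edge set counts as finished, so a new task is
  sought in every round.\<close>

definition new_task :: "nat set \<Rightarrow> nat set set \<Rightarrow> nat set \<times> nat set set" where
  "new_task Y E =
     (if \<exists>P H. admissible Y P H \<and> H \<subseteq> E then SOME (P, H). admissible Y P H \<and> H \<subseteq> E else ({}, {}))"

text \<open>\<open>M\<close> and \<open>U\<close> describe the position before the round,
  \<open>B\<close> is Breaker's move in it. The completion of a task is thus registered only at the
  next update, and \<open>M \<union> (U - B)\<close> are the edges that Maker owns or can still
  get.\<close>

fun update :: "nat set set \<Rightarrow> nat set set \<Rightarrow> nat set set \<Rightarrow> state \<Rightarrow> state" where
  "update M U B (Y, P, H, x) =
     (let Y' = (if H \<subseteq> M then Y - P else Y);
          PH = (if H \<subseteq> M \<or> H \<inter> B \<noteq> {} then new_task Y' (M \<union> (U - B)) else (P, H))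
      in (Y', fst PH, snd PH, x + (if H \<inter> B = {} then 0 else if P = {} then n else 1)))"

definition init :: state where
  "init = ({..<n} - C, {}, core, 0)"

text \<open>Histories grow at the end, hence the reversal. The new state is fixed as soon as Breaker
  has moved, which lets \<open>strat\<close> consult it before replying.\<close>

fun rev_state :: "history \<Rightarrow> state" where
  "rev_state [] = init"
| "rev_state ((B, m) # h) = update (maker_edges (rev h)) (unclaimed n (rev h)) B (rev_state h)"

definition state_of :: "history \<Rightarrow> state" where
  "state_of h = rev_state (rev h)"

definition strat :: strategy where
  "strat h B = (case update (maker_edges h) (unclaimed n h) B (state_of h) of (Y, P, H, x) \<Rightarrow>
     let R = unclaimed n h - B in
     if H \<inter> R = {} then SOME e. e \<in> R else SOME e. e \<in> H \<inter> R)"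

lemma state_of_Nil: "state_of [] = init"
  by (simp add: state_of_def)

lemma state_of_snoc:
  "state_of (h @ [(B, m)]) = update (maker_edges h) (unclaimed n h) B (state_of h)"
  by (simp add: state_of_def)

lemma strat_cases:
  assumes "state_of (h @ [(B, m)]) = (Y, P, H, x)" "unclaimed n h - B \<noteq> {}"
  shows "strat h B \<in> unclaimed n h - B"
    and "H \<inter> (unclaimed n h - B) \<noteq> {} \<Longrightarrow> strat h B \<in> H"
proof -
  let ?R = "unclaimed n h - B"
  have eq: "strat h B = (if H \<inter> ?R = {} then SOME e. e \<in> ?R else SOME e. e \<in> H \<inter> ?R)"
    using assms(1) by (simp add: strat_def state_of_snoc)
  show "strat h B \<in> ?R" "H \<inter> ?R \<noteq> {} \<Longrightarrow> strat h B \<in> H"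
    unfolding eq using assms(2) someI_ex[of "\<lambda>e. e \<in> ?R"] someI_ex[of "\<lambda>e. e \<in> H \<inter> ?R"]
    by (auto split: if_splits)
qed

lemma maker_strategy_strat: "maker_strategy n strat"
  unfolding maker_strategy_def
proof (intro allI impI)
  fix h B assume "B \<subseteq> unclaimed n h \<and> unclaimed n h - B \<noteq> {}"
  moreover obtain Y P H x where "state_of (h @ [(B, None)]) = (Y, P, H, x)"
    using prod_cases4 by blast
  ultimately show "strat h B \<in> unclaimed n h - B" using strat_cases(1) by blast
qed

lemma new_task_cases:
  assumes "new_task Y E = (P, H)"
  obtains "admissible Y P H" "H \<subseteq> E" | "P = {}" "H = {}" "\<nexists>P H. admissible Y P H \<and> H \<subseteq> E"
proof (cases "\<exists>P H. admissible Y P H \<and> H \<subseteq> E")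
  case True
  then have "\<exists>z. case z of (P, H) \<Rightarrow> admissible Y P H \<and> H \<subseteq> E" by auto
  from someI_ex[OF this] have "admissible Y P H \<and> H \<subseteq> E"
    using assms True by (simp add: new_task_def)
  then show ?thesis using that by blast
next
  case False
  then have "P = {}" "H = {}" using assms unfolding new_task_def if_not_P[OF False] by auto
  then show ?thesis using that False by blast
qed

text \<open>Invariants that hold whatever Breaker does. The last one says that each round of the
  initial stage gains a core edge, so that this stage is short.\<close>

lemma play_state:
  assumes "play n b strat h" "state_of h = (Y, P, H, x)"
  shows "Y \<subseteq> {..<n} - C" "H \<subseteq> maker_edges h \<union> unclaimed n h"
    and "\<And>v. v \<in> {..<n} - C - Y \<Longrightarrow> fan k C (maker_edges h) v"
    and "P \<noteq> {} \<Longrightarrow> admissible Y P H"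
    and "P = {} \<Longrightarrow> H = {} \<or> (H = core \<and> Y = {..<n} - C \<and> x = 0 \<and> length h \<le> card (core \<inter> maker_edges h))"
proof -
  have "Y \<subseteq> {..<n} - C \<and> H \<subseteq> maker_edges h \<union> unclaimed n h \<and>
    (\<forall>v \<in> {..<n} - C - Y. fan k C (maker_edges h) v) \<and>
    (P \<noteq> {} \<longrightarrow> admissible Y P H) \<and>
    (P = {} \<longrightarrow> H = {} \<or> (H = core \<and> Y = {..<n} - C \<and> x = 0 \<and> length h \<le> card (core \<inter> maker_edges h)))"
    using assms
  proof (induction arbitrary: Y P H x rule: play.induct)
    case Nil
    then show ?case using core_complete by (auto simp: state_of_Nil init_def unclaimed_def)
  next
    case (snoc h B)
    obtain Y0 P0 H0 x0 where st: "state_of h = (Y0, P0, H0, x0)" using prod_cases4 by blast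
    let ?M = "maker_edges h" and ?U = "unclaimed n h"
    let ?M' = "maker_edges (h @ [(B, Some (strat h B))])"
    note IH = snoc.IH[OF st]
    note ms = strat_cases[OF snoc.prems snoc.hyps(4)]
    have MB: "?M \<inter> B = {}" using snoc.hyps(2) by (auto simp: unclaimed_def)
    have MU: "?M' \<union> unclaimed n (h @ [(B, Some (strat h B))]) = ?M \<union> (?U - B)"
      using ms(1) by (auto simp: unclaimed_snoc)
    have upd: "update ?M ?U B (Y0, P0, H0, x0) = (Y, P, H, x)"
      using snoc.prems st by (simp add: state_of_snoc)
    have Y: "Y = (if H0 \<subseteq> ?M then Y0 - P0 else Y0)"
      using upd by (simp add: Let_def split: if_splits)
    have YY: "Y \<subseteq> {..<n} - C" using Y IH by auto
    have fan: "fan k C ?M' v" if "v \<in> {..<n} - C - Y" for v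
    proof (cases "v \<in> Y0")
      case True
      then have "H0 \<subseteq> ?M" "v \<in> P0" using that Y by (auto split: if_splits)
      then have "fan k C H0 v" using IH by (auto simp: admissible_def)
      then show ?thesis by (rule fan_mono) (use \<open>H0 \<subseteq> ?M\<close> in auto)
    next
      case False
      then have "fan k C ?M v" using IH that by auto
      then show ?thesis by (rule fan_mono) auto
    qed
    show ?case
    proof (cases "H0 \<subseteq> ?M \<or> H0 \<inter> B \<noteq> {}")
      case True
      then have nt: "new_task Y (?M \<union> (?U - B)) = (P, H)"
        using upd Y by (auto simp: Let_def split: if_splits)
      show ?thesis
        by (rule new_task_cases[OF nt]) (use MU YY fan in \<open>auto simp: admissible_def\<close>)
    next
      case False
      then have eq: "Y = Y0" "P = P0" "H = H0" "x = x0" using upd by (auto simp: Let_def)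
      have HR: "H \<subseteq> ?M \<union> (?U - B)" using IH False eq by auto
      have "length (h @ [(B, Some (strat h B))]) \<le> card (core \<inter> ?M')"
        if "P = {}" "H \<noteq> {}"
      proof -
        have H: "H = core" "length h \<le> card (core \<inter> ?M)" using that IH eq by auto
        \<comment> \<open>The core task is neither finished nor spoiled, so one of its edges is free
          and Maker takes it.\<close>
        have "H \<inter> (?U - B) \<noteq> {}" using HR False eq by auto
        then have e: "strat h B \<in> H" "strat h B \<notin> ?M" using ms by (auto simp: unclaimed_def)
        have "finite (core \<inter> ?M)"
          using core_complete finite_complete_edges finite_subset by blast
        moreover have "core \<inter> ?M' = insert (strat h B) (core \<inter> ?M)" using e H by auto
        ultimately show ?thesis using e H by simp
      qed
      then show ?thesis using HR MU YY fan IH eq by auto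
    qed
  qed
  then show "Y \<subseteq> {..<n} - C" "H \<subseteq> maker_edges h \<union> unclaimed n h"
    "\<And>v. v \<in> {..<n} - C - Y \<Longrightarrow> fan k C (maker_edges h) v"
    "P \<noteq> {} \<Longrightarrow> admissible Y P H"
    "P = {} \<Longrightarrow> H = {} \<or> (H = core \<and> Y = {..<n} - C \<and> x = 0 \<and> length h \<le> card (core \<inter> maker_edges h))"
    by blast+
qed

section \<open>Penalties and progress\<close>

definition penalty :: "history \<Rightarrow> nat" where
  "penalty h = snd (snd (snd (state_of h)))"

definition task_edges :: "history \<Rightarrow> nat set set" where
  "task_edges h = fst (snd (snd (state_of h)))"

lemma penalty_Nil: "penalty [] = 0"
  by (simp add: penalty_def state_of_Nil init_def)

text \<open>Only spoiling the core costs \<open>n\<close>, and the core is the current task only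
  while the history has length at most \<open>card core\<close>. Other tasks may occur early as
  well, hence the maximum with 1.\<close>

lemma penalty_snoc:
  assumes "play n b strat h"
  shows "real (penalty (h @ [(B, m)])) \<le> penalty h +
    (if task_edges h \<inter> B = {} then 0 else if length h \<le> card core then max n 1 else 1)"
proof -
  obtain Y P H x where st: "state_of h = (Y, P, H, x)" using prod_cases4 by blast
  have fin: "finite core" using core_complete finite_complete_edges finite_subset by blast
  have "P = {} \<Longrightarrow> H = {} \<or> length h \<le> card core"
    using play_state(5)[OF assms st] card_mono[OF fin, of "core \<inter> maker_edges h"] by auto
  then show ?thesis
    using st by (auto simp: penalty_def task_edges_def state_of_snoc Let_def)
qed

lemma penalty_mono: "penalty h \<le> penalty (h @ [(B, m)])"
proof -
  obtain Y P H x where st: "state_of h = (Y, P, H, x)" using prod_cases4 by blast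
  then show ?thesis by (simp add: penalty_def state_of_snoc Let_def)
qed

lemma task_edges_card:
  assumes "play n b strat h"
  shows "card (task_edges h) \<le> (if length h \<le> card core then max s (card core) else s)"
    and "finite (task_edges h)"
proof -
  obtain Y P H x where st: "state_of h = (Y, P, H, x)" using prod_cases4 by blast
  have fin: "finite core" using core_complete finite_complete_edges finite_subset by blast
  note ps = play_state[OF assms st]
  have "P = {} \<Longrightarrow> H = {} \<or> (H = core \<and> length h \<le> card core)"
    using ps(5) card_mono[OF fin, of "core \<inter> maker_edges h"] by auto
  then show "card (task_edges h) \<le> (if length h \<le> card core then max s (card core) else s)"
    using ps(4) st by (cases "P = {}") (auto simp: task_edges_def admissible_def)
  have "H \<subseteq> complete_edges n"
    using ps(4,5) core_complete by (cases "P = {}") (auto simp: admissible_def)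
  then show "finite (task_edges h)"
    using st finite_complete_edges finite_subset by (auto simp: task_edges_def)
qed

text \<open>\<open>Z\<close> stands for the edges that Breaker owns after the last round under consideration, so a task
  that avoids \<open>Z\<close> is available at all earlier times.\<close>

lemma play_progress:
  assumes "play n b strat h" "state_of h = (Y, P, H, x)"
    and avail: "\<And>Y. Y \<subseteq> {..<n} - C \<Longrightarrow> Y \<noteq> {} \<Longrightarrow> \<exists>P H. admissible Y P H \<and> H \<inter> Z = {}"
    and "breaker_edges h \<subseteq> Z" "penalty h < n"
  shows "(P = {} \<and> H = core \<and> Y = {..<n} - C \<and> length h \<le> card (core \<inter> maker_edges h)) \<or>
    (core \<subseteq> maker_edges h \<and> (Y = {} \<or> P \<noteq> {} \<and>
      length h + w (card Y) \<le> card core + w (card ({..<n} - C)) + s * x + card (H \<inter> maker_edges h)))"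
  using assms(1,2,4,5)
proof (induction arbitrary: Y P H x rule: play.induct)
  case Nil
  then show ?case by (auto simp: state_of_Nil init_def)
next
  case (snoc h B)
  obtain Y0 P0 H0 x0 where st: "state_of h = (Y0, P0, H0, x0)" using prod_cases4 by blast
  let ?M = "maker_edges h" and ?U = "unclaimed n h"
  let ?h' = "h @ [(B, Some (strat h B))]"
  let ?M' = "maker_edges ?h'"
  have Z: "breaker_edges h \<subseteq> Z" "B \<subseteq> Z" using snoc.prems by auto
  have pen: "penalty h < n" using snoc.prems(3) penalty_mono le_less_trans by blast
  note IH = snoc.IH[OF st Z(1) pen]
  note ms = strat_cases[OF snoc.prems(1) snoc.hyps(4)]
  note ps = play_state[OF snoc.hyps(1) st]
  have play': "play n b strat ?h'" using snoc.hyps by (rule play.snoc)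
  note ps' = play_state[OF play' snoc.prems(1)]
  have fin: "finite core" using core_complete finite_complete_edges finite_subset by blast
  have MB: "?M \<inter> B = {}" using snoc.hyps(2) by (auto simp: unclaimed_def)
  have Mc: "?M' \<subseteq> complete_edges n"
    by (rule play_subset[OF play' maker_strategy_strat])
  then have finM: "finite ?M'" using finite_complete_edges finite_subset by blast
  have upd: "update ?M ?U B (Y0, P0, H0, x0) = (Y, P, H, x)"
    using snoc.prems(1) st by (simp add: state_of_snoc)
  have Y: "Y = (if H0 \<subseteq> ?M then Y0 - P0 else Y0)"
    and x: "x = x0 + (if H0 \<inter> B = {} then 0 else if P0 = {} then n else 1)"
    using upd by (simp_all add: Let_def split: if_splits)
  have xn: "x < n" using snoc.prems by (simp add: penalty_def)
  consider (A) "\<not> (H0 \<subseteq> ?M \<or> H0 \<inter> B \<noteq> {})" | (N) "H0 \<subseteq> ?M \<or> H0 \<inter> B \<noteq> {}" by blast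
  then show ?case
  proof cases
    case A
    then have eq: "Y = Y0" "P = P0" "H = H0" "x = x0" using upd by (auto simp: Let_def)
    have "H \<inter> (?U - B) \<noteq> {}" using ps(2) A eq by auto
    then have e: "strat h B \<in> H" "strat h B \<notin> ?M" using ms by (auto simp: unclaimed_def)
    have "H \<inter> ?M' = insert (strat h B) (H \<inter> ?M)" using e by auto
    then have c: "card (H \<inter> ?M') = card (H \<inter> ?M) + 1" using e finM by simp
    show ?thesis using IH
    proof (elim disjE conjE)
      assume "P0 = {}" "H0 = core" "Y0 = {..<n} - C" "length h \<le> card (core \<inter> ?M)"
      then show ?thesis using c eq by simp
    next
      assume "core \<subseteq> ?M" "Y0 = {}"
      then show ?thesis using eq by auto
    next
      assume "core \<subseteq> ?M" "P0 \<noteq> {}" "length h + w (card Y0)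
        \<le> card core + w (card ({..<n} - C)) + s * x0 + card (H0 \<inter> ?M)"
      then show ?thesis using c eq by auto
    qed
  next
    case N
    then have nt: "new_task Y (?M \<union> (?U - B)) = (P, H)"
      using upd Y by (auto simp: Let_def split: if_splits)
    \<comment> \<open>Spoiling the core would have raised the penalty to \<open>n\<close>.\<close>
    have P0: "H0 \<inter> B = {} \<or> P0 \<noteq> {}" using x xn by (auto split: if_splits)
    have core: "core \<subseteq> ?M"
      using IH N P0 by auto
    \<comment> \<open>The inequality without a current task. Finishing a task is paid for by the
      drop of \<open>w\<close>; if a task is spoiled, at most \<open>s\<close> edges were wasted on
      it, and the new penalty unit pays for them through \<open>s * x\<close>.\<close>
    have bound: "length h + w (card Y) \<le> card core + w (card ({..<n} - C)) + s * x" if "Y \<noteq> {}"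
      using IH
    proof (elim disjE conjE)
      assume *: "P0 = {}" "H0 = core" "Y0 = {..<n} - C" "length h \<le> card (core \<inter> ?M)"
      moreover have "card (core \<inter> ?M) \<le> card core" by (intro card_mono fin) auto
      ultimately have "length h \<le> card core + s * x" by linarith
      then have "real (length h) \<le> card core + s * x" by (metis of_nat_le_iff)
      then show ?thesis using Y * by auto
    next
      assume "Y0 = {}"
      then show ?thesis using that Y by (auto split: if_splits)
    next
      assume *: "P0 \<noteq> {}" "length h + w (card Y0)
        \<le> card core + w (card ({..<n} - C)) + s * x0 + card (H0 \<inter> ?M)"
      then have adm: "admissible Y0 P0 H0" using ps by blast
      show ?thesis
      proof (cases "H0 \<subseteq> ?M")
        case True
        then have "Y = Y0 - P0" "x = x0" "H0 \<inter> ?M = H0" using Y x MB by auto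
        then show ?thesis using * adm by (simp add: admissible_def)
      next
        case False
        then have "Y = Y0" "x = x0 + 1" using Y x N * by auto
        moreover have "card (H0 \<inter> ?M) \<le> card H0" "card H0 \<le> s"
          using adm finite_subset[OF _ finite_complete_edges]
          by (auto simp: admissible_def intro!: card_mono)
        ultimately show ?thesis using * by (simp add: algebra_simps)
      qed
    qed
    show ?thesis
    proof (cases "Y = {}")
      case True
      then show ?thesis using core by auto
    next
      case False
      have "Y \<subseteq> {..<n} - C" by (rule ps'(1))
      then obtain P1 H1 where adm1: "admissible Y P1 H1" "H1 \<inter> Z = {}" using avail False by blast
      have "H1 \<subseteq> ?M \<union> (?U - B)"
        using adm1 Z by (auto simp: admissible_def unclaimed_def)
      then have adm: "admissible Y P H" "H \<subseteq> ?M \<union> (?U - B)"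
        using new_task_cases[OF nt] adm1 by metis+
      then have "P \<noteq> {}" "H \<noteq> {}" by (auto simp: admissible_def)
      \<comment> \<open>One owned edge of the new task accounts for the round just played: either
        the whole task is already owned, or Maker's reply lies in it.\<close>
      have "H \<inter> ?M' \<noteq> {}"
      proof (cases "H \<inter> (?U - B) = {}")
        case True
        then show ?thesis using adm \<open>H \<noteq> {}\<close> by auto
      next
        case False
        then show ?thesis using ms(2) by auto
      qed
      then have "card (H \<inter> ?M') \<ge> 1" using finM by (simp add: Suc_le_eq card_gt_0_iff)
      then show ?thesis using core bound False \<open>P \<noteq> {}\<close> by auto
    qed
  qed
qed

text \<open>A play longer than the whole budget rules out both unfinished alternatives of
  \<open>play_progress\<close>; so the core is complete and no vertex lacks a fan.\<close>

lemma task_strategy_wins: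
  assumes h: "play n b strat h"
    and avail: "\<And>Y. Y \<subseteq> {..<n} - C \<Longrightarrow> Y \<noteq> {} \<Longrightarrow> \<exists>P H. admissible Y P H \<and> H \<inter> breaker_edges h = {}"
    and pen: "penalty h < n"
    and len: "card core + w (card ({..<n} - C)) + s * penalty h + s < length h"
    and C: "C \<subseteq> {..<n}" and n: "k < n"
    and core: "\<And>X c d E. \<lbrakk>core \<subseteq> E; finite X; card X < k; c \<in> C - X; d \<in> C - X\<rbrakk> \<Longrightarrow> (c, d) \<in> (avoiding E X)\<^sup>*"
  shows "maker_wins n k h"
proof -
  let ?M = "maker_edges h"
  obtain Y P H x where st: "state_of h = (Y, P, H, x)" using prod_cases4 by blast
  have fin: "finite core" using core_complete finite_complete_edges finite_subset by blast
  note ps = play_state[OF h st]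
  have x: "penalty h = x" using st by (simp add: penalty_def)
  have "card (core \<inter> ?M) \<le> card core" by (intro card_mono fin) auto
  moreover have "real (card core) < length h"
    using len w_nonneg[of "card ({..<n} - C)"] by (smt (verit) mult_nonneg_nonneg of_nat_0_le_iff)
  ultimately have "\<not> length h \<le> card (core \<inter> ?M)" by linarith
  moreover have "card (H \<inter> ?M) \<le> s" if "P \<noteq> {}"
  proof -
    have "admissible Y P H" using ps(4) that .
    then have "card (H \<inter> ?M) \<le> card H" "card H \<le> s"
      using finite_subset[OF _ finite_complete_edges]
      by (auto simp: admissible_def intro!: card_mono)
    then show ?thesis by simp
  qed
  then have "\<not> (P \<noteq> {} \<and> length h + w (card Y) \<le> card core + w (card ({..<n} - C)) + s * x + card (H \<inter> ?M))"
    using len x w_nonneg[of "card Y"] by (smt (verit) of_nat_le_iff)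
  ultimately have *: "core \<subseteq> ?M" "Y = {}"
    using play_progress[OF h st avail subset_refl pen] by blast+
  have "\<Union>?M \<subseteq> {..<n}"
    using play_subset[OF h maker_strategy_strat] by (auto simp: complete_edges_def)
  then have "vertex_connected k {..<n} ?M"
    using * ps(3) core n by (intro vertex_connected_if_fan[OF _ _ C]) auto
  then show ?thesis by (simp add: maker_wins_def)
qed

end

section \<open>The random Breaker\<close>

text \<open>The quotient of the two binomials is the product of \<open>(b - i) / (u - i)\<close>
  over \<open>i < j\<close>, and each factor is at most \<open>b / u\<close>.\<close>

lemma binomial_shift_le:
  assumes "j \<le> b" "b \<le> u"
  shows "real ((u - j) choose (b - j)) \<le> (real b / real u) ^ j * real (u choose b)"
  using assms(1)
proof (induction j)
  case (Suc j)
  let ?C = "real ((u - j) choose (b - j))" and ?D = "real ((u - Suc j) choose (b - Suc j))"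
  have "(b - j) * ((u - j) choose (b - j)) = (u - j) * ((u - j - 1) choose (b - j - 1))"
    using Suc.prems by (intro times_binomial_minus1_eq) simp
  then have "real (b - j) * ?C = real (u - j) * ?D" by (metis diff_Suc_eq_diff_pred diff_commute of_nat_mult)
  then have D: "?D = real (b - j) / real (u - j) * ?C" using Suc.prems assms(2) by (simp add: field_simps)
  have "real j * real b \<le> real j * real u" using assms(2) by (intro mult_left_mono) auto
  then have "real (b - j) / real (u - j) \<le> real b / real u"
    using Suc.prems assms(2) by (simp add: field_simps of_nat_diff)
  then have "?D \<le> real b / real u * ?C" unfolding D by (intro mult_right_mono) auto
  also have "\<dots> \<le> real b / real u * ((real b / real u) ^ j * real (u choose b))"
    using Suc by (intro mult_left_mono) auto
  finally show ?case by simp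
qed simp

text \<open>Removing \<open>F\<close> maps these sets bijectively to the subsets of
  \<open>U - F\<close> of size \<open>b - card F\<close>. Hence a random \<open>b\<close>-set
  contains \<open>F\<close> at most as often as if its elements were chosen independently.\<close>

lemma card_supersets_le:
  assumes "finite U" "F \<subseteq> U" "b \<le> card U"
  shows "real (card {B. B \<subseteq> U \<and> card B = b \<and> F \<subseteq> B})
    \<le> (real b / card U) ^ card F * real (card U choose b)"
proof (cases "card F \<le> b")
  case True
  have finF: "finite F" using assms finite_subset by blast
  have "bij_betw (\<lambda>B. B - F) {B. B \<subseteq> U \<and> card B = b \<and> F \<subseteq> B} {B. B \<subseteq> U - F \<and> card B = b - card F}"
  proof (rule bij_betwI[where g = "\<lambda>B. B \<union> F"], goal_cases)
    case 1
    then show ?case using finF by (auto simp: card_Diff_subset)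
  next
    case 2
    have "card (B \<union> F) = b" if "B \<subseteq> U - F" "card B = b - card F" for B
      using that finF True finite_subset[OF that(1)] assms(1)
      by (subst card_Un_disjoint) auto
    then show ?case using assms(2) by auto
  qed auto
  then have "card {B. B \<subseteq> U \<and> card B = b \<and> F \<subseteq> B} = card {B. B \<subseteq> U - F \<and> card B = b - card F}"
    by (rule bij_betw_same_card)
  also have "\<dots> = (card U - card F) choose (b - card F)"
    using assms finF by (subst n_subsets) (auto simp: card_Diff_subset)
  finally show ?thesis using binomial_shift_le[OF True assms(3)] by simp
next
  case False
  have "\<not> F \<subseteq> B" if "B \<subseteq> U" "card B = b" for B
    using that False assms(1) finite_subset card_mono by metis
  then have "{B. B \<subseteq> U \<and> card B = b \<and> F \<subseteq> B} = {}" by blast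
  then show ?thesis by (simp only: card.empty) simp
qed

text \<open>The right-hand side is what independent membership with probability
  \<open>b / card U\<close> would give. The product is expanded into terms that require
  \<open>G \<subseteq> B\<close> and have coefficients that are nonnegative because
  \<open>y \<le> 2\<close>; each is bounded by \<open>card_supersets_le\<close>, and the sum is
  folded back.\<close>

lemma sum_subsets_prod_le:
  fixes y :: real
  assumes U: "finite U" "F \<subseteq> U" "b \<le> card U" and y: "0 \<le> y" "y \<le> 2"
  shows "(\<Sum>B | B \<subseteq> U \<and> card B = b. 2 ^ card (F \<inter> B) * y ^ card (F - B))
    \<le> real (card U choose b) * (y + (2 - y) * (real b / card U)) ^ card F"
proof -
  let ?S = "{B. B \<subseteq> U \<and> card B = b}" and ?p = "real b / card U"
  have finF: "finite F" using assms finite_subset by blast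
  have finS: "finite ?S" by (rule finite_subset[of _ "Pow U"]) (use U in auto)
  have expand: "2 ^ card (F \<inter> B) * y ^ card (F - B) =
      (\<Sum>G\<in>Pow F. if G \<subseteq> B then (2 - y) ^ card G * y ^ card (F - G) else 0)" for B
  proof -
    have "2 ^ card (F \<inter> B) * y ^ card (F - B) = (\<Prod>e\<in>F \<inter> B. 2) * (\<Prod>e\<in>F - B. y)" by simp
    also have "\<dots> = (\<Prod>e\<in>F. if e \<in> B then 2 else y)"
      using finF by (simp add: prod.If_cases Int_def Diff_eq Collect_neg_eq[symmetric] cong: conj_cong)
    \<comment> \<open>Writing 2 as \<open>(2 - y) + y\<close> leaves only conditions of the form
      \<open>e \<in> B\<close> in the expansion.\<close>
    also have "\<dots> = (\<Prod>e\<in>F. (if e \<in> B then 2 - y else 0) + y)" by (intro prod.cong) auto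
    also have "\<dots> = (\<Sum>G\<in>Pow F. (\<Prod>e\<in>G. if e \<in> B then 2 - y else 0) * (\<Prod>e\<in>F - G. y))"
      by (rule prod_add[OF finF])
    also have "\<dots> = (\<Sum>G\<in>Pow F. if G \<subseteq> B then (2 - y) ^ card G * y ^ card (F - G) else 0)"
    proof (rule sum.cong[OF refl])
      fix G assume "G \<in> Pow F"
      then have "finite G" using finF finite_subset by auto
      have "(\<Prod>e\<in>G. if e \<in> B then 2 - y else 0) = (if G \<subseteq> B then (2 - y) ^ card G else 0)"
      proof (cases "G \<subseteq> B")
        case True
        then have "(\<Prod>e\<in>G. if e \<in> B then 2 - y else 0) = (\<Prod>e\<in>G. 2 - y)"
          by (intro prod.cong) auto
        then show ?thesis using True by simp
      next
        case False
        then show ?thesis using \<open>finite G\<close> by (auto intro!: prod_zero)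
      qed
      then show "(\<Prod>e\<in>G. if e \<in> B then 2 - y else 0) * (\<Prod>e\<in>F - G. y) =
        (if G \<subseteq> B then (2 - y) ^ card G * y ^ card (F - G) else 0)" by simp
    qed
    finally show ?thesis .
  qed
  have "(\<Sum>B\<in>?S. 2 ^ card (F \<inter> B) * y ^ card (F - B)) =
      (\<Sum>G\<in>Pow F. \<Sum>B\<in>?S. if G \<subseteq> B then (2 - y) ^ card G * y ^ card (F - G) else 0)"
    unfolding expand by (rule sum.swap)
  also have "\<dots> = (\<Sum>G\<in>Pow F. real (card {B. B \<subseteq> U \<and> card B = b \<and> G \<subseteq> B}) * ((2 - y) ^ card G * y ^ card (F - G)))"
  proof (rule sum.cong[OF refl])
    fix G
    have "?S \<inter> {B. G \<subseteq> B} = {B. B \<subseteq> U \<and> card B = b \<and> G \<subseteq> B}" by auto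
    then show "(\<Sum>B\<in>?S. if G \<subseteq> B then (2 - y) ^ card G * y ^ card (F - G) else 0) =
      real (card {B. B \<subseteq> U \<and> card B = b \<and> G \<subseteq> B}) * ((2 - y) ^ card G * y ^ card (F - G))"
      using finS by (simp add: sum.If_cases)
  qed
  also have "\<dots> \<le> (\<Sum>G\<in>Pow F. (?p ^ card G * real (card U choose b)) * ((2 - y) ^ card G * y ^ card (F - G)))"
    by (intro sum_mono mult_right_mono card_supersets_le) (use U y in auto)
  also have "\<dots> = real (card U choose b) * (\<Sum>G\<in>Pow F. (\<Prod>e\<in>G. (2 - y) * ?p) * (\<Prod>e\<in>F - G. y))"
    unfolding sum_distrib_left
    by (intro sum.cong refl) (simp add: power_mult_distrib[symmetric] power_divide mult_ac)
  also have "(\<Sum>G\<in>Pow F. (\<Prod>e\<in>G. (2 - y) * ?p) * (\<Prod>e\<in>F - G. y)) = (\<Prod>e\<in>F. (2 - y) * ?p + y)"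
    by (rule prod_add[OF finF, symmetric])
  finally show ?thesis by (simp add: add.commute)
qed

text \<open>A union bound over the single elements of \<open>D\<close>.\<close>

lemma card_subsets_meeting_le:
  assumes "finite U" "b \<le> card U" "finite D"
  shows "real (card {B. B \<subseteq> U \<and> card B = b \<and> D \<inter> B \<noteq> {}})
    \<le> card D * (real b / card U) * real (card U choose b)"
proof -
  let ?G = "\<lambda>e. {B. B \<subseteq> U \<and> card B = b \<and> {e} \<subseteq> B}"
  have fin: "finite (?G e)" for e by (rule finite_subset[of _ "Pow U"]) (use assms in auto)
  have "{B. B \<subseteq> U \<and> card B = b \<and> D \<inter> B \<noteq> {}} = (\<Union>e\<in>D \<inter> U. ?G e)" by auto
  then have "card {B. B \<subseteq> U \<and> card B = b \<and> D \<inter> B \<noteq> {}} \<le> (\<Sum>e\<in>D \<inter> U. card (?G e))"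
    using card_UN_le[of "D \<inter> U" ?G] assms by simp
  from of_nat_mono[OF this, where 'a = real] have "real (card {B. B \<subseteq> U \<and> card B = b \<and> D \<inter> B \<noteq> {}}) \<le> (\<Sum>e\<in>D \<inter> U. real (card (?G e)))"
    by simp
  also have "\<dots> \<le> (\<Sum>e\<in>D \<inter> U. real b / card U * real (card U choose b))"
  proof (intro sum_mono)
    fix e assume "e \<in> D \<inter> U"
    then show "real (card (?G e)) \<le> real b / card U * real (card U choose b)"
      using card_supersets_le[of U "{e}" b] assms by auto
  qed
  also have "\<dots> = card (D \<inter> U) * (real b / card U) * real (card U choose b)" by simp
  also have "\<dots> \<le> card D * (real b / card U) * real (card U choose b)"
    using assms by (intro mult_right_mono of_nat_mono card_mono) auto
  finally show ?thesis .
qed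

lemma breaker_move_eq:
  assumes "b \<le> card (unclaimed n h)"
  shows "breaker_move n b h = pmf_of_set {B. B \<subseteq> unclaimed n h \<and> card B = b}"
    and "finite {B. B \<subseteq> unclaimed n h \<and> card B = b}" "{B. B \<subseteq> unclaimed n h \<and> card B = b} \<noteq> {}"
    and "card {B. B \<subseteq> unclaimed n h \<and> card B = b} = card (unclaimed n h) choose b"
proof -
  show "breaker_move n b h = pmf_of_set {B. B \<subseteq> unclaimed n h \<and> card B = b}"
    using assms by (simp add: breaker_move_def min_absorb1)
  show "finite {B. B \<subseteq> unclaimed n h \<and> card B = b}"
    by (rule finite_subset[of _ "Pow (unclaimed n h)"]) (auto simp: finite_unclaimed)
  show "{B. B \<subseteq> unclaimed n h \<and> card B = b} \<noteq> {}"
    using obtain_subset_with_card_n[OF assms] by blast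
  show "card {B. B \<subseteq> unclaimed n h \<and> card B = b} = card (unclaimed n h) choose b"
    by (rule n_subsets[OF finite_unclaimed])
qed

section \<open>Supermartingales along the play\<close>

context
  fixes n b :: nat and S :: strategy
  assumes S: "maker_strategy n S"
begin

text \<open>Until the board runs short every round removes exactly \<open>b + 1\<close> edges; this
  links the random process to \<open>play\<close>.\<close>

lemma set_play_rounds:
  assumes "t * (b + 1) \<le> n choose 2" "h \<in> set_pmf (play_rounds n b S t)"
  shows "play n b S h \<and> length h = t \<and> card (unclaimed n h) = (n choose 2) - t * (b + 1)"
  using assms
proof (induction t arbitrary: h)
  case 0
  then show ?case by (simp add: play.Nil unclaimed_def card_complete_edges)
next
  case (Suc t)
  obtain h0 where h0: "h0 \<in> set_pmf (play_rounds n b S t)"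
    and h: "h \<in> set_pmf (if unclaimed n h0 = {} then return_pmf h0 else play_round n b S h0)"
    using Suc.prems by auto
  have IH: "play n b S h0" "length h0 = t" "card (unclaimed n h0) = (n choose 2) - t * (b + 1)"
    using Suc.IH[OF _ h0] Suc.prems by auto
  have big: "b + 1 \<le> card (unclaimed n h0)" using IH Suc.prems by simp
  then have "unclaimed n h0 \<noteq> {}" by auto
  moreover have "set_pmf (breaker_move n b h0) = {B. B \<subseteq> unclaimed n h0 \<and> card B = b}"
    using breaker_move_eq[of b n h0] big by simp
  ultimately obtain B where B: "B \<subseteq> unclaimed n h0" "card B = b"
    and hB: "h = h0 @ [(B, if unclaimed n h0 - B = {} then None else Some (S h0 B))]"
    using h by (auto simp: play_round_def)
  have finB: "finite B" using B finite_unclaimed finite_subset by blast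
  have cD: "card (unclaimed n h0 - B) = card (unclaimed n h0) - b"
    using B finB by (simp add: card_Diff_subset)
  then have ne: "unclaimed n h0 - B \<noteq> {}" using big by (metis add_le_imp_le_diff card.empty not_one_le_zero add.commute)
  then have hh: "h = h0 @ [(B, Some (S h0 B))]" using hB by auto
  have SB: "S h0 B \<in> unclaimed n h0 - B" using S B ne by (auto simp: maker_strategy_def)
  have "play n b S h" unfolding hh using IH B ne by (intro play.snoc) auto
  moreover have "card (unclaimed n h) = card (unclaimed n h0) - b - 1"
    using SB cD finite_unclaimed[of n h0] by (simp add: hh unclaimed_snoc)
  ultimately show ?case using IH hh by simp
qed

lemma finite_set_play_round: "finite (set_pmf (play_round n b S h))"
proof -
  let ?A = "{B. B \<subseteq> unclaimed n h \<and> card B = min b (card (unclaimed n h))}"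
  have "finite ?A" by (rule finite_subset[of _ "Pow (unclaimed n h)"]) (auto simp: finite_unclaimed)
  moreover have "?A \<noteq> {}"
    using obtain_subset_with_card_n[of "min b (card (unclaimed n h))" "unclaimed n h"] by auto
  ultimately show ?thesis by (simp add: play_round_def breaker_move_def)
qed

lemma finite_set_play_rounds: "finite (set_pmf (play_rounds n b S t))"
  by (induction t) (auto simp: finite_set_play_round)

text \<open>The hypothesis \<open>step\<close> makes \<open>g\<close> a supermartingale: it averages
  over Breaker's uniform move, cleared of the denominator.\<close>

lemma expectation_play_rounds_le:
  fixes g :: "nat \<Rightarrow> history \<Rightarrow> real"
  assumes T: "T * (b + 1) \<le> n choose 2"
    and step: "\<And>t h. \<lbrakk>t < T; play n b S h; length h = t; card (unclaimed n h) = (n choose 2) - t * (b + 1)\<rbrakk> \<Longrightarrow>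
      (\<Sum>B | B \<subseteq> unclaimed n h \<and> card B = b. g (Suc t) (h @ [(B, Some (S h B))]))
        \<le> real (card (unclaimed n h) choose b) * g t h"
    and "t \<le> T"
  shows "measure_pmf.expectation (play_rounds n b S t) (g t) \<le> g 0 []"
  using assms(3)
proof (induction t)
  case (Suc t)
  let ?P = "play_rounds n b S t"
  let ?f = "\<lambda>h. if unclaimed n h = {} then return_pmf h else play_round n b S h"
  have tT: "Suc t * (b + 1) \<le> n choose 2"
    using T Suc.prems by (meson le_trans mult_le_mono1)
  then have tT': "t * (b + 1) \<le> n choose 2" by simp
  have "measure_pmf.expectation (play_rounds n b S (Suc t)) (g (Suc t)) =
      (\<Sum>h\<in>set_pmf ?P. pmf ?P h *\<^sub>R measure_pmf.expectation (?f h) (g (Suc t)))"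
    unfolding play_rounds.simps
  proof (rule pmf_expectation_bind[OF finite_set_play_rounds _ subset_refl])
    show "finite (set_pmf (?f h))" for h using finite_set_play_round by simp
  qed
  also have "\<dots> \<le> (\<Sum>h\<in>set_pmf ?P. pmf ?P h *\<^sub>R g t h)"
  proof (intro sum_mono scaleR_left_mono)
    fix h assume "h \<in> set_pmf ?P"
    then have h: "play n b S h" "length h = t" "card (unclaimed n h) = (n choose 2) - t * (b + 1)"
      using set_play_rounds[OF tT'] by auto
    have big: "b + 1 \<le> card (unclaimed n h)" using h tT by simp
    let ?A = "{B. B \<subseteq> unclaimed n h \<and> card B = b}"
    note mv = breaker_move_eq[of b n h]
    have ne: "unclaimed n h - B \<noteq> {}" if "B \<in> ?A" for B
    proof
      assume "unclaimed n h - B = {}"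
      then have "unclaimed n h = B" using that by auto
      then show False using that big by auto
    qed
    have "measure_pmf.expectation (?f h) (g (Suc t)) = measure_pmf.expectation (pmf_of_set ?A)
        (\<lambda>B. g (Suc t) (h @ [(B, if unclaimed n h - B = {} then None else Some (S h B))]))"
      using big mv by (auto simp: play_round_def)
    also have "\<dots> = (\<Sum>B\<in>?A. g (Suc t) (h @ [(B, if unclaimed n h - B = {} then None else Some (S h B))])) / card ?A"
      using big mv by (intro integral_pmf_of_set) auto
    also have "\<dots> = (\<Sum>B\<in>?A. g (Suc t) (h @ [(B, Some (S h B))])) / card ?A"
      using ne by (intro arg_cong2[of _ _ _ _ "(/)"] sum.cong) auto
    also have "\<dots> \<le> g t h"
    proof -
      have "0 < real (card (unclaimed n h) choose b)" using big by simp
      then show ?thesis using step[OF _ h] Suc.prems big mv(4) by (simp add: field_simps)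
    qed
    finally show "measure_pmf.expectation (?f h) (g (Suc t)) \<le> g t h" .
  qed auto
  also have "\<dots> = measure_pmf.expectation ?P (g t)"
    by (subst integral_measure_pmf[OF finite_set_play_rounds]) auto
  finally show ?case using Suc by simp
qed simp

text \<open>Breaker's uniform \<open>b\<close>-sets are negatively correlated, hence \<open>2 ^ card (F \<inter> breaker_edges h)\<close> is
  dominated as if every edge of \<open>F\<close> were claimed independently with probability \<open>q\<close>. In the
  supermartingale, an edge that is unclaimed when \<open>u t\<close> edges are left has weight \<open>1 + q\<^sub>t\<close>, where
  \<open>1 - q\<^sub>t = u T / u t\<close> is the probability that it would still be unclaimed after \<open>T\<close> rounds.\<close>

lemma expectation_two_power_le:
  assumes T: "T * (b + 1) < n choose 2" and F: "F \<subseteq> complete_edges n"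
  shows "measure_pmf.expectation (play_rounds n b S T) (\<lambda>h. 2 ^ card (F \<inter> breaker_edges h))
    \<le> (1 + real (T * (b + 1)) / real (n choose 2)) ^ card F"
proof -
  define u where "u t = real (n choose 2) - real t * (real b + 1)" for t
  define y where "y t = 2 - u T / u t" for t
  define g where "g t h = 2 ^ card (F \<inter> breaker_edges h) * y t ^ card (F \<inter> unclaimed n h)" for t h
  have finF: "finite F" using F finite_complete_edges finite_subset by blast
  have uT: "0 < u T" using T unfolding u_def
    by (simp only: of_nat_less_iff[symmetric, where 'a = real] of_nat_mult of_nat_add of_nat_1 diff_gt_0_iff_gt)
  have umono: "u t \<le> u t'" if "t' \<le> t" for t t'
    using that by (simp add: u_def mult_right_mono)
  have yrange: "1 \<le> y t" "y t \<le> 2" if "t \<le> T" for t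
    using umono[OF that] uT by (auto simp: y_def field_simps)
  have step: "(\<Sum>B | B \<subseteq> unclaimed n h \<and> card B = b. g (Suc t) (h @ [(B, Some (S h B))]))
        \<le> real (card (unclaimed n h) choose b) * g t h"
    if t: "t < T" and h: "play n b S h" "length h = t" "card (unclaimed n h) = (n choose 2) - t * (b + 1)" for t h
  proof -
    let ?U = "unclaimed n h" and ?F = "F \<inter> unclaimed n h"
    have "Suc t * (b + 1) \<le> T * (b + 1)" using t by (intro mult_right_mono) auto
    then have tT: "Suc t * (b + 1) < n choose 2" using T by simp
    have cu: "real (card ?U) = u t" using tT h(3) by (simp add: u_def of_nat_diff algebra_simps)
    have bU: "b \<le> card ?U" using tT h(3) by simp
    have uS: "u (Suc t) = u t - b - 1" by (simp add: u_def algebra_simps)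
    have pos: "0 < u (Suc t)" "0 < u t" using umono[of "Suc t" T] umono[of t T] uT t by auto
    have yS: "1 \<le> y (Suc t)" "y (Suc t) \<le> 2" using yrange t by auto
    \<comment> \<open>Maker's own edge can only lower the value, because the weight of an unclaimed
      edge is at least 1.\<close>
    have "g (Suc t) (h @ [(B, Some (S h B))]) \<le> 2 ^ card (F \<inter> breaker_edges h) * (2 ^ card (?F \<inter> B) * y (Suc t) ^ card (?F - B))"
      if "B \<subseteq> ?U" for B
    proof -
      have "F \<inter> breaker_edges (h @ [(B, Some (S h B))]) = (F \<inter> breaker_edges h) \<union> (?F \<inter> B)"
        using that by auto
      moreover have "card \<dots> = card (F \<inter> breaker_edges h) + card (?F \<inter> B)"
        using finF by (intro card_Un_disjoint) (auto simp: unclaimed_def)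
      ultimately have 1: "card (F \<inter> breaker_edges (h @ [(B, Some (S h B))])) = card (F \<inter> breaker_edges h) + card (?F \<inter> B)"
        by simp
      have "card (F \<inter> unclaimed n (h @ [(B, Some (S h B))])) \<le> card (?F - B)"
        using finF by (intro card_mono) (auto simp: unclaimed_snoc)
      then have 2: "y (Suc t) ^ card (F \<inter> unclaimed n (h @ [(B, Some (S h B))])) \<le> y (Suc t) ^ card (?F - B)"
        using yS by (intro power_increasing) auto
      show ?thesis unfolding g_def 1 using 2 yS by (simp add: power_add mult.assoc mult_left_mono)
    qed
    then have "(\<Sum>B | B \<subseteq> ?U \<and> card B = b. g (Suc t) (h @ [(B, Some (S h B))])) \<le>
      (\<Sum>B | B \<subseteq> ?U \<and> card B = b. 2 ^ card (F \<inter> breaker_edges h) * (2 ^ card (?F \<inter> B) * y (Suc t) ^ card (?F - B)))"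
      by (intro sum_mono) auto
    also have "\<dots> = 2 ^ card (F \<inter> breaker_edges h) *
      (\<Sum>B | B \<subseteq> ?U \<and> card B = b. 2 ^ card (?F \<inter> B) * y (Suc t) ^ card (?F - B))"
      by (simp add: sum_distrib_left)
    also have "\<dots> \<le> 2 ^ card (F \<inter> breaker_edges h) *
      (real (card ?U choose b) * (y (Suc t) + (2 - y (Suc t)) * (real b / card ?U)) ^ card ?F)"
      using yS bU finite_unclaimed by (intro mult_left_mono sum_subsets_prod_le) auto
    also have "\<dots> \<le> 2 ^ card (F \<inter> breaker_edges h) * (real (card ?U choose b) * y t ^ card ?F)"
    proof -
      \<comment> \<open>An unclaimed edge survives Breaker's move with probability
        \<open>(u t - b) / u t\<close>. As Maker also takes an edge, \<open>u (Suc t)\<close> is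
        less than \<open>u t - b\<close>, which gives the inequality.\<close>
      have "u T / u t \<le> u T / u (Suc t) * ((u t - b) / u t)"
      proof -
        have "u T / u (Suc t) * ((u t - b) / u t) = u T / u t * ((u t - b) / u (Suc t))" by simp
        moreover have "1 \<le> (u t - b) / u (Suc t)" using pos uS by simp
        moreover have "0 \<le> u T / u t" using uT pos by simp
        ultimately show ?thesis using mult_left_mono[of 1 "(u t - b) / u (Suc t)" "u T / u t"] by (simp add: mult.commute)
      qed
      also have "(u t - b) / u t = 1 - b / u t" using pos by (simp add: field_simps)
      finally have "y (Suc t) + (2 - y (Suc t)) * (real b / card ?U) \<le> y t"
        unfolding cu y_def by (simp add: algebra_simps)
      moreover have "0 \<le> y (Suc t) + (2 - y (Suc t)) * (real b / card ?U)" using yS by simp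
      ultimately show ?thesis by (intro mult_left_mono power_mono) auto
    qed
    finally show ?thesis by (simp add: g_def mult_ac)
  qed
  have "measure_pmf.expectation (play_rounds n b S T) (g T) \<le> g 0 []"
    using T by (intro expectation_play_rounds_le[where T = T] step) auto
  moreover have "g T = (\<lambda>h. 2 ^ card (F \<inter> breaker_edges h))" using uT by (simp add: g_def y_def fun_eq_iff)
  moreover have "g 0 [] = (1 + real (T * (b + 1)) / real (n choose 2)) ^ card F"
  proof -
    have "F \<inter> unclaimed n [] = F" using F by (auto simp: unclaimed_def)
    moreover have "y 0 = 1 + real (T * (b + 1)) / real (n choose 2)"
    proof -
      have "0 < n choose 2" using T by linarith
      then have "0 < real (n choose 2)" by (simp only: of_nat_0_less_iff)
      then show ?thesis by (simp add: y_def u_def field_simps)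
    qed
    ultimately show ?thesis by (simp add: g_def)
  qed
  ultimately show ?thesis by simp
qed

text \<open>Markov's inequality for \<open>2 ^ card (F \<inter> breaker_edges h)\<close>. For
  \<open>q < 1\<close> and small \<alpha> the base of the bound is below 1.\<close>

lemma prob_breaker_claims_many_le:
  fixes \<alpha> q :: real
  assumes T: "T * (b + 1) < n choose 2" and F: "F \<subseteq> complete_edges n"
    and q: "real (T * (b + 1)) \<le> q * real (n choose 2)"
  shows "measure_pmf.prob (play_rounds n b S T) {h. (1 - \<alpha>) * card F \<le> card (F \<inter> breaker_edges h)}
    \<le> ((1 + q) / 2 powr (1 - \<alpha>)) ^ card F"
proof -
  let ?P = "play_rounds n b S T"
  let ?X = "\<lambda>h. 2 ^ card (F \<inter> breaker_edges h) :: real"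
  have "0 < n choose 2" using T by linarith
  then have pos: "0 < real (n choose 2)" by (simp only: of_nat_0_less_iff)
  have "measure_pmf.prob ?P {h. (1 - \<alpha>) * card F \<le> card (F \<inter> breaker_edges h)}
      \<le> measure_pmf.prob ?P {h \<in> space ?P. 2 powr ((1 - \<alpha>) * card F) \<le> ?X h}"
    by (intro measure_pmf.finite_measure_mono) (auto simp: powr_realpow[symmetric])
  also have "\<dots> \<le> measure_pmf.expectation ?P ?X / 2 powr ((1 - \<alpha>) * card F)"
    by (intro integral_Markov_inequality_measure[where A = "{}"] integrable_measure_pmf_finite
          finite_set_play_rounds) auto
  also have "\<dots> \<le> (1 + q) ^ card F / 2 powr ((1 - \<alpha>) * card F)"
  proof (intro divide_right_mono)
    have "(1 + real (T * (b + 1)) / real (n choose 2)) ^ card F \<le> (1 + q) ^ card F"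
      using q pos by (intro power_mono) (auto simp: field_simps)
    then show "measure_pmf.expectation ?P ?X \<le> (1 + q) ^ card F"
      using expectation_two_power_le[OF T F] by linarith
  qed auto
  also have "2 powr ((1 - \<alpha>) * card F) = (2 powr (1 - \<alpha>)) ^ card F"
    by (simp add: powr_powr[symmetric] powr_realpow)
  finally show ?thesis by (simp add: power_divide)
qed

end

section \<open>The expected penalty\<close>

context task_strategy
begin

text \<open>A current task \<open>D\<close> is spoiled with probability at most
  \<open>card D * \<mu>\<close>, since \<mu> bounds \<open>b / card U\<close> during the first
  \<open>T\<close> rounds. The penalty plus the bounds for the remaining rounds is a
  supermartingale.\<close>

lemma expectation_penalty_le:
  fixes \<mu> :: real
  assumes T: "T * (b + 1) < n choose 2"
    and \<mu>: "real b \<le> \<mu> * (real (n choose 2) - real (T * (b + 1)))" "0 \<le> \<mu>"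
    and n: "0 < n"
  shows "measure_pmf.expectation (play_rounds n b strat T) (\<lambda>h. real (penalty h))
    \<le> (card core + 1) * (n * (max s (card core) * \<mu>)) + T * (s * \<mu>)"
proof -
  \<comment> \<open>Bounds the expected increase of the penalty in one round. The large term covers
    the at most \<open>card core + 1\<close> rounds in which the core may be at stake.\<close>
  define \<eta> where "\<eta> t = s * \<mu> + (if t \<le> card core then n * (max s (card core) * \<mu>) else 0)" for t
  define g where "g t h = real (penalty h) + (\<Sum>i\<in>{t..<T}. \<eta> i)" for t h
  have step: "(\<Sum>B | B \<subseteq> unclaimed n h \<and> card B = b. g (Suc t) (h @ [(B, Some (strat h B))]))
        \<le> real (card (unclaimed n h) choose b) * g t h"
    if t: "t < T" and h: "play n b strat h" "length h = t" "card (unclaimed n h) = (n choose 2) - t * (b + 1)" for t h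
  proof -
    let ?U = "unclaimed n h" and ?D = "task_edges h"
    let ?A = "{B. B \<subseteq> ?U \<and> card B = b}"
    let ?W = "if t \<le> card core then real n else 1"
    have "Suc t * (b + 1) \<le> T * (b + 1)" using t by (intro mult_right_mono) auto
    then have tT: "t * (b + 1) + (b + 1) \<le> T * (b + 1)" by simp
    have bU: "b \<le> card ?U" using tT T h(3) by simp
    have "0 < card ?U" "(n choose 2) \<le> card ?U + T * (b + 1)" using tT T h(3) by linarith+
    then have cU: "real (n choose 2) - real (T * (b + 1)) \<le> card ?U" "0 < card ?U"
      by (simp_all only: of_nat_add[symmetric] of_nat_le_iff diff_le_eq)
    note A = breaker_move_eq(2-4)[OF bU]
    have "real b \<le> \<mu> * card ?U"
      using \<mu> cU(1) by (meson mult_left_mono order_trans)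
    then have p: "real b / card ?U \<le> \<mu>" using cU(2) by (simp add: field_simps)
    have "(\<Sum>B\<in>?A. g (Suc t) (h @ [(B, Some (strat h B))])) \<le>
      (\<Sum>B\<in>?A. penalty h + (\<Sum>i\<in>{Suc t..<T}. \<eta> i) + (if ?D \<inter> B \<noteq> {} then ?W else 0))"
    proof (intro sum_mono)
      fix B
      have "real (penalty (h @ [(B, Some (strat h B))])) \<le> penalty h + (if ?D \<inter> B \<noteq> {} then ?W else 0)"
        using penalty_snoc[OF h(1), of B "Some (strat h B)"] n h(2) by (auto split: if_splits)
      then show "g (Suc t) (h @ [(B, Some (strat h B))]) \<le>
        penalty h + (\<Sum>i\<in>{Suc t..<T}. \<eta> i) + (if ?D \<inter> B \<noteq> {} then ?W else 0)"
        by (simp add: g_def)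
    qed
    also have "\<dots> = card ?A * (penalty h + (\<Sum>i\<in>{Suc t..<T}. \<eta> i)) +
        ?W * card {B. B \<subseteq> ?U \<and> card B = b \<and> ?D \<inter> B \<noteq> {}}"
    proof -
      have "?A \<inter> {B. ?D \<inter> B \<noteq> {}} = {B. B \<subseteq> ?U \<and> card B = b \<and> ?D \<inter> B \<noteq> {}}" by auto
      then show ?thesis using A(1) by (simp add: sum.distrib sum.If_cases)
    qed
    also have "\<dots> \<le> card ?A * (penalty h + (\<Sum>i\<in>{Suc t..<T}. \<eta> i)) + \<eta> t * card ?A"
    proof -
      have "real (card {B. B \<subseteq> ?U \<and> card B = b \<and> ?D \<inter> B \<noteq> {}})
          \<le> card ?D * (real b / card ?U) * real (card ?U choose b)"
        using task_edges_card(2)[OF h(1)] bU finite_unclaimed by (intro card_subsets_meeting_le) auto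
      also have "\<dots> \<le> card ?D * \<mu> * real (card ?U choose b)"
        using p by (intro mult_left_mono mult_right_mono) auto
      finally have "?W * card {B. B \<subseteq> ?U \<and> card B = b \<and> ?D \<inter> B \<noteq> {}} \<le> ?W * (card ?D * \<mu> * card ?A)"
        unfolding A(3) by (intro mult_left_mono) auto
      also have "\<dots> = ?W * (card ?D * \<mu>) * card ?A" by simp
      also have "\<dots> \<le> \<eta> t * card ?A"
      proof (intro mult_right_mono)
        have "real (card ?D) * \<mu> \<le> (if t \<le> card core then max s (card core) else s) * \<mu>"
          using task_edges_card(1)[OF h(1)] h(2) \<mu>(2) by (intro mult_right_mono of_nat_mono) auto
        then have "?W * (real (card ?D) * \<mu>) \<le> ?W * ((if t \<le> card core then max s (card core) else s) * \<mu>)"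
          by (intro mult_left_mono) auto
        also have "\<dots> \<le> \<eta> t" using \<mu>(2) by (auto simp: \<eta>_def)
        finally show "?W * (real (card ?D) * \<mu>) \<le> \<eta> t" .
      qed auto
      finally show ?thesis by simp
    qed
    also have "\<dots> = real (card ?U choose b) * g t h"
      using t A(3) by (simp add: g_def sum.atLeast_Suc_lessThan algebra_simps)
    finally show ?thesis .
  qed
  have "measure_pmf.expectation (play_rounds n b strat T) (g T) \<le> g 0 []"
    using T by (intro expectation_play_rounds_le[OF maker_strategy_strat, where T = T] step) auto
  moreover have "g T = (\<lambda>h. real (penalty h))" by (simp add: g_def fun_eq_iff)
  moreover have "(\<Sum>i\<in>{0..<T}. \<eta> i) \<le> (card core + 1) * (n * (max s (card core) * \<mu>)) + T * (s * \<mu>)"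
  proof -
    let ?c = "n * (max s (card core) * \<mu>)"
    have "(\<Sum>i\<in>{0..<T}. if i \<le> card core then ?c else 0) = card ({0..<T} \<inter> {i. i \<le> card core}) * ?c"
      by (simp add: sum.If_cases)
    also have "\<dots> \<le> card {0..card core} * ?c"
      using \<mu>(2) by (intro mult_right_mono of_nat_mono card_mono) auto
    finally show ?thesis by (simp add: \<eta>_def sum.distrib)
  qed
  ultimately show ?thesis by (simp add: g_def penalty_Nil)
qed

end

section \<open>The probability of winning\<close>

text \<open>Each pair of \<open>A \<times> U\<close> either gives an edge of \<open>Z\<close> or is
  counted at its endpoint in \<open>A\<close>.\<close>

lemma card_cross_split:
  assumes "finite A" "finite U" "A \<inter> U = {}"
  shows "card A * card U \<le> card (cross A U \<inter> Z) + (\<Sum>a\<in>A. card {u \<in> U. {a, u} \<notin> Z})"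
proof -
  have fin: "finite (cross A U)" by (rule finite_cross[OF assms(1,2)])
  have "card A * card U = card ((cross A U \<inter> Z) \<union> (cross A U - Z))"
    using card_cross[OF assms(3)] by (simp add: Int_Diff_Un)
  also have "\<dots> = card (cross A U \<inter> Z) + card (cross A U - Z)"
    using fin by (intro card_Un_disjoint) auto
  also have "card (cross A U - Z) \<le> (\<Sum>a\<in>A. card {u \<in> U. {a, u} \<notin> Z})"
  proof -
    have eq: "cross A U - Z = (\<lambda>(a, u). {a, u}) ` (SIGMA a:A. {u \<in> U. {a, u} \<notin> Z})"
      by (auto simp: cross_def)
    have "card (cross A U - Z) \<le> card (SIGMA a:A. {u \<in> U. {a, u} \<notin> Z})"
      unfolding eq using assms by (intro card_image_le finite_SigmaI) auto
    also have "\<dots> = (\<Sum>a\<in>A. card {u \<in> U. {a, u} \<notin> Z})" using assms by (intro card_SigmaI) auto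
    finally show ?thesis .
  qed
  finally show ?thesis by simp
qed

text \<open>The first term pays for strips, at \<open>k / 2\<close> edges per vertex with some
  slack. The second falls only once fewer than \<open>\<gamma> * n\<close> vertices are left, and
  then pays the \<open>k\<close> edges of each star.\<close>

definition task_weight :: "nat \<Rightarrow> real \<Rightarrow> nat \<Rightarrow> nat \<Rightarrow> real" where
  "task_weight k \<gamma> n z = (1 + \<gamma>) * (real k / 2) * real z + real k * min (real z) (\<gamma> * real n)"

text \<open>While at least \<open>\<gamma> * n\<close> vertices remain, the density of the free
  edges yields a strip; after that a single vertex is joined to the core by a star.\<close>

lemma admissible_exists:
  fixes \<alpha> \<beta> \<gamma> :: real and n k s K L :: nat
  assumes ts: "task_strategy n core (task_weight k \<gamma> n)"
    and k: "k \<ge> 2" and L: "1 \<le> L" "2 * k \<le> \<gamma> * L" and s: "s = k * L + 2 * k * k"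
    and \<gamma>: "0 < \<gamma>" and \<alpha>: "0 < \<alpha>" "\<alpha> \<le> 1"
    and \<beta>: "L \<le> \<beta>" "\<beta> \<le> \<alpha> ^ L * (\<gamma> * n - (K + L))"
    and C: "C \<subseteq> {..<n}"
    and star: "\<And>v. v \<in> {..<n} - C \<Longrightarrow> k \<le> card {c \<in> C. {v, c} \<notin> Z}"
    and dense: "\<And>A U. \<lbrakk>A \<subseteq> {..<n}; U \<subseteq> {..<n}; A \<inter> U = {}; card A = K; \<beta> \<le> real (card U)\<rbrakk> \<Longrightarrow>
       \<exists>a\<in>A. \<alpha> * card U \<le> card {u \<in> U. {a, u} \<notin> Z}"
    and Y: "Y \<subseteq> {..<n} - C" "Y \<noteq> {}"
  shows "\<exists>P H. task_strategy.admissible n k s C (task_weight k \<gamma> n) Y P H \<and> H \<inter> Z = {}"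
proof -
  interpret task_strategy n b k s C core "task_weight k \<gamma> n" for b by (rule ts)
  let ?w = "task_weight k \<gamma> n"
  have finY: "finite Y" using Y(1) finite_subset by blast
  have "\<exists>N. \<forall>v\<in>Y. N v \<subseteq> {c \<in> C. {v, c} \<notin> Z} \<and> card (N v) = k"
  proof (rule bchoice, rule ballI)
    fix v assume "v \<in> Y"
    then have "k \<le> card {c \<in> C. {v, c} \<notin> Z}" using star Y by auto
    then show "\<exists>x. x \<subseteq> {c \<in> C. {v, c} \<notin> Z} \<and> card x = k"
      by (rule obtain_subset_with_card_n) blast
  qed
  then obtain N where N: "\<And>v. v \<in> Y \<Longrightarrow> N v \<subseteq> {c \<in> C. {v, c} \<notin> Z}" "\<And>v. v \<in> Y \<Longrightarrow> card (N v) = k"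
    by blast
  have finN: "finite (N v)" if "v \<in> Y" for v using N(2)[OF that] k by (metis card.infinite not_numeral_le_zero)
  have NZ: "cross {v} (N v) \<inter> Z = {}" if "v \<in> Y" for v using N(1)[OF that] by (auto simp: cross_def)
  have Nc: "cross {v} (N v) \<subseteq> complete_edges n" if "v \<in> Y" for v
    using N(1)[OF that] that Y C by (intro cross_complete) auto
  show ?thesis
  proof (cases "\<gamma> * n \<le> card Y")
    case False
    obtain v where v: "v \<in> Y" using Y by blast
    have ck: "card (cross {v} (N v)) = k" using N[OF v] v Y by (subst card_cross) auto
    have "k * 1 \<le> k * (2 * k)" using k by (intro mult_left_mono) auto
    then have ks: "k \<le> s" unfolding s by linarith
    have "1 \<le> card Y" using v finY by (metis One_nat_def Suc_leI card_gt_0_iff empty_iff)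
    then have "?w (card Y) = ?w (card (Y - {v})) + (1 + \<gamma>) * (real k / 2) + k"
      using False v finY by (simp add: task_weight_def of_nat_diff field_simps min_def)
    moreover have "0 \<le> (1 + \<gamma>) * (real k / 2)" using \<gamma> by simp
    ultimately have "k + ?w (card (Y - {v})) \<le> ?w (card Y)" by linarith
    moreover have "fan k C (cross {v} (N v)) v" using N[OF v] by (intro fan_star[of "N v"]) auto
    moreover have "cross {v} (N v) \<noteq> {}" using ck k by auto
    ultimately have "admissible Y {v} (cross {v} (N v))"
      unfolding admissible_def using ck ks v Nc by auto
    then show ?thesis using NZ v by blast
  next
    case True
    have Lpos: "0 < \<alpha> ^ L * (\<gamma> * n - (K + L))" using \<beta> L by linarith
    then have "K + L < \<gamma> * n" using \<alpha> by (simp add: zero_less_mult_iff)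
    then have "real (K + L) \<le> real (card Y)" using True by simp
    then have KL: "K + L \<le> card Y" by (simp only: of_nat_le_iff)
    \<comment> \<open>\<open>K + L\<close> vertices leave at least \<open>K\<close> candidates for
      each of the \<open>L\<close> greedy choices.\<close>
    then obtain A where A: "A \<subseteq> Y" "card A = K + L" by (rule obtain_subset_with_card_n) blast
    have finA: "finite A" using A finY finite_subset by blast
    define U where "U = Y - A"
    have cU: "real (card U) = card Y - (K + L)" unfolding U_def using A finA KL by (simp add: card_Diff_subset of_nat_diff)
    have "\<alpha> ^ L * (\<gamma> * n - (K + L)) \<le> \<alpha> ^ L * card U"
      using cU True \<alpha> by (intro mult_left_mono) auto
    then have \<beta>U: "\<beta> \<le> \<alpha> ^ L * card U" using \<beta>(2) by linarith
    have "\<exists>S U'. S \<subseteq> A \<and> card S = L \<and> U' \<subseteq> U \<and> \<alpha> ^ L * card U \<le> card U' \<and> (\<forall>a\<in>S. \<forall>u\<in>U'. {a, u} \<notin> Z)"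
    proof (rule greedy_biclique[where K = K and \<beta> = \<beta>])
      fix A' U' assume "A' \<subseteq> A" "U' \<subseteq> U" "card A' = K" "\<beta> \<le> real (card U')"
      then show "\<exists>a\<in>A'. \<alpha> * card U' \<le> card {u \<in> U'. {a, u} \<notin> Z}"
        using A Y by (intro dense) (auto simp: U_def)
    qed (use finA finY A \<alpha> \<beta>U in \<open>auto simp: U_def\<close>)
    then obtain S U' where S: "S \<subseteq> A" "card S = L" and U': "U' \<subseteq> U" "\<alpha> ^ L * card U \<le> card U'"
      and free: "\<And>a u. a \<in> S \<Longrightarrow> u \<in> U' \<Longrightarrow> {a, u} \<notin> Z" by blast
    have "real L \<le> real (card U')" using U' \<beta> \<beta>U by linarith
    then have "L \<le> card U'" by (simp only: of_nat_le_iff)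
    then obtain V where V: "V \<subseteq> U'" "card V = L" by (rule obtain_subset_with_card_n) blast
    have SV: "S \<inter> V = {}" "S \<subseteq> Y" "V \<subseteq> Y" using S V U' A by (auto simp: U_def)
    have finSV: "finite S" "finite V" using SV finY finite_subset by blast+
    obtain a where a: "bij_betw a {..<L} S"
      using ex_bij_betw_nat_finite[OF finSV(1)] S by (auto simp: atLeast0LessThan)
    obtain c where c: "bij_betw c {..<L} V"
      using ex_bij_betw_nat_finite[OF finSV(2)] V by (auto simp: atLeast0LessThan)
    have im: "a ` {..<L} = S" "c ` {..<L} = V" using a c by (auto simp: bij_betw_def)
    have inj: "inj_on a {..<L}" "inj_on c {..<L}" using a c by (auto simp: bij_betw_def)
    let ?H = "strip k L a c N" and ?P = "S \<union> V"
    have sub: "?H \<subseteq> cross S V \<union> (\<Union>x\<in>?P. cross {x} (N x))"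
      using strip_subset[of k L a c N] im by simp
    have PY: "?P \<subseteq> Y" using SV by auto
    have "cross S V \<subseteq> complete_edges n" using SV Y by (intro cross_complete) auto
    then have Hc: "?H \<subseteq> complete_edges n" using sub Nc PY by blast
    have "cross S V \<inter> Z = {}" using free V by (auto simp: cross_def)
    then have HZ: "?H \<inter> Z = {}" using sub NZ PY by blast
    have cardH: "card ?H \<le> s"
      unfolding s using finN N(2) PY im by (intro card_strip_le) blast
    have fan: "fan k C ?H v" if "v \<in> ?P" for v
      by (rule fan_strip[OF k inj]) (use im SV N PY that in \<open>blast+\<close>)
    have "{a 0, c 0} \<in> ?H" unfolding strip_def using L k by force
    then have ne: "?H \<noteq> {}" by blast
    have cP: "card ?P = 2 * L" using SV finSV S V by (simp add: card_Un_disjoint)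
    have PY': "card ?P \<le> card Y" using PY finY by (rule card_mono[rotated])
    have cYP: "real (card (Y - ?P)) = real (card Y) - 2 * real L"
      using PY finSV cP PY' by (simp add: card_Diff_subset of_nat_diff)
    have "real k * min (real (card Y) - 2 * real L) (\<gamma> * n) \<le> real k * min (real (card Y)) (\<gamma> * n)"
      by (intro mult_left_mono) auto
    then have "?w (card Y) - ?w (card (Y - ?P)) \<ge> (1 + \<gamma>) * (real k / 2) * (2 * L)"
      unfolding task_weight_def cYP by (simp add: field_simps)
    \<comment> \<open>Since \<open>2 * k \<le> \<gamma> * L\<close>, the \<open>2 * k * k\<close>
      edges at the ends fit into the slack \<open>\<gamma> * k * L\<close>.\<close>
    moreover have "real s \<le> (1 + \<gamma>) * (real k / 2) * (2 * L)"
    proof -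
      have "real k * (2 * k) \<le> real k * (\<gamma> * L)" using L by (intro mult_left_mono) auto
      then show ?thesis by (simp add: s algebra_simps)
    qed
    ultimately have "card ?H + ?w (card (Y - ?P)) \<le> ?w (card Y)" using cardH by linarith
    moreover have "?P \<noteq> {}" using cP L by auto
    ultimately have "admissible Y ?P ?H"
      unfolding admissible_def using PY Hc cardH fan ne by auto
    then show ?thesis using HZ by blast
  qed
qed

text \<open>The three error terms account for a vertex with too few free edges to the core, for a pair
  \<open>(A, U)\<close> with too few free edges, and for a penalty of at least \<open>\<theta>\<close>.\<close>

lemma prob_maker_wins_ge:
  fixes \<alpha> \<beta> \<gamma> \<theta> \<mu> \<rho> q :: real and k m n b s K L T :: nat
  assumes k: "k \<ge> 2" and L: "1 \<le> L" "2 * k \<le> \<gamma> * L" and s: "s = k * L + 2 * k * k"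
    and \<gamma>: "0 < \<gamma>" and \<alpha>: "0 < \<alpha>" "\<alpha> \<le> 1"
    and \<beta>: "L \<le> \<beta>" "\<beta> \<le> \<alpha> ^ L * (\<gamma> * n - (K + L))"
    and m: "k \<le> m" "k + m < n" "k \<le> \<alpha> * (k + m)"
    and T: "T * (b + 1) < n choose 2" "real (T * (b + 1)) \<le> q * real (n choose 2)"
    and \<rho>: "\<rho> = (1 + q) / 2 powr (1 - \<alpha>)" "0 < \<rho>" "\<rho> < 1"
    and \<mu>: "real b \<le> \<mu> * (real (n choose 2) - real (T * (b + 1)))" "0 \<le> \<mu>"
    and \<theta>: "0 < \<theta>" "\<theta> \<le> n"
    and len: "k * m + ((1 + \<gamma>) * (real k / 2) * n + real k * (\<gamma> * n)) + s * \<theta> + s < T"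
  shows "\<exists>S. maker_strategy n S \<and>
    1 - (n * \<rho> ^ (k + m) + 4 ^ n * \<rho> powr (K * \<beta>) +
         ((k * m + 1) * (n * (max s (k * m) * \<mu>)) + T * (s * \<mu>)) / \<theta>)
      \<le> measure_pmf.prob (play_rounds n b S T) {h. length h = T \<and> maker_wins n k h}"
proof -
  define D where "D = {..<k}"
  define R where "R = {k..<k + m}"
  define C where "C = {..<k + m}"
  define core where "core = cross D R"
  have CD: "C = D \<union> R" and DO: "D \<inter> R = {}" by (auto simp: C_def D_def R_def)
  have cc: "card core = k * m" unfolding core_def card_cross[OF DO] by (simp add: D_def R_def)
  interpret task_strategy n b k s C core "task_weight k \<gamma> n"
  proof
    show "core \<subseteq> complete_edges n"
      unfolding core_def using DO m by (intro cross_complete) (auto simp: D_def R_def)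
    show "0 \<le> task_weight k \<gamma> n z" for z using \<gamma> by (simp add: task_weight_def)
  qed
  let ?P = "play_rounds n b strat T"
  let ?V = "{..<n}"
  note S = maker_strategy_strat
  define bad1 where "bad1 v = {h. (1 - \<alpha>) * card (cross {v} C) \<le> card (cross {v} C \<inter> breaker_edges h)}" for v
  define bad2 where "bad2 = (\<lambda>(A, U). {h. (1 - \<alpha>) * card (cross A U) \<le> card (cross A U \<inter> breaker_edges h)})"
  define I where "I = {(A, U). A \<subseteq> ?V \<and> U \<subseteq> ?V \<and> A \<inter> U = {} \<and> card A = K \<and> \<beta> \<le> real (card U)}"
  define bad3 where "bad3 = {h. \<theta> \<le> real (penalty h)}"
  have IPow: "I \<subseteq> Pow ?V \<times> Pow ?V" by (auto simp: I_def)
  then have finI: "finite I" by (rule finite_subset) auto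
  have "measure_pmf.prob ?P (\<Union>v\<in>?V - C. bad1 v) \<le> (\<Sum>v\<in>?V - C. measure_pmf.prob ?P (bad1 v))"
    by (intro measure_pmf.finite_measure_subadditive_finite) auto
  also have "\<dots> \<le> (\<Sum>v\<in>?V - C. \<rho> ^ (k + m))"
  proof (intro sum_mono)
    fix v assume v: "v \<in> ?V - C"
    then have disj: "{v} \<inter> C = {}" by auto
    have "cross {v} C \<subseteq> complete_edges n"
      using v m by (intro cross_complete) (auto simp: C_def)
    then have "measure_pmf.prob ?P (bad1 v) \<le> \<rho> ^ card (cross {v} C)"
      unfolding bad1_def \<rho>(1) by (intro prob_breaker_claims_many_le[OF S T(1) _ T(2)])
    then show "measure_pmf.prob ?P (bad1 v) \<le> \<rho> ^ (k + m)"
      unfolding card_cross[OF disj] by (simp add: C_def)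
  qed
  also have "\<dots> \<le> n * \<rho> ^ (k + m)"
  proof -
    have "card (?V - C) \<le> n" by (metis Diff_subset card_lessThan card_mono finite_lessThan)
    then show ?thesis using \<rho> by (simp add: mult_right_mono)
  qed
  finally have p1: "measure_pmf.prob ?P (\<Union>v\<in>?V - C. bad1 v) \<le> n * \<rho> ^ (k + m)" .
  have "measure_pmf.prob ?P (\<Union>x\<in>I. bad2 x) \<le> (\<Sum>x\<in>I. measure_pmf.prob ?P (bad2 x))"
    using finI by (intro measure_pmf.finite_measure_subadditive_finite) auto
  also have "\<dots> \<le> (\<Sum>x\<in>I. \<rho> powr (K * \<beta>))"
  proof (intro sum_mono)
    fix x assume "x \<in> I"
    then obtain A U where x: "x = (A, U)" "A \<subseteq> ?V" "U \<subseteq> ?V" "A \<inter> U = {}" "card A = K" "\<beta> \<le> card U"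
      by (auto simp: I_def)
    have "cross A U \<subseteq> complete_edges n" using x by (intro cross_complete)
    then have "measure_pmf.prob ?P (bad2 x) \<le> \<rho> ^ card (cross A U)"
      unfolding bad2_def \<rho>(1) x(1) prod.case by (intro prob_breaker_claims_many_le[OF S T(1) _ T(2)])
    also have "\<dots> = \<rho> powr (K * card U)" using \<rho> x by (simp add: card_cross powr_realpow[symmetric])
    also have "\<dots> \<le> \<rho> powr (K * \<beta>)" using \<rho> x by (intro powr_mono') (auto simp: mult_left_mono)
    finally show "measure_pmf.prob ?P (bad2 x) \<le> \<rho> powr (K * \<beta>)" .
  qed
  \<comment> \<open>There are at most \<open>4 ^ n\<close> pairs of subsets; \<beta> will be linear
    in \<open>n\<close>, so that a large constant \<open>K\<close> beats this factor.\<close>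
  also have "\<dots> \<le> 4 ^ n * \<rho> powr (K * \<beta>)"
  proof -
    have "card I \<le> card (Pow ?V \<times> Pow ?V)" by (rule card_mono[OF _ IPow]) simp
    also have "\<dots> = 4 ^ n" by (simp add: card_cartesian_product card_Pow power_mult_distrib[symmetric])
    finally have "real (card I) \<le> 4 ^ n" by (metis of_nat_le_iff of_nat_numeral of_nat_power)
    then show ?thesis by (simp add: mult_right_mono)
  qed
  finally have p2: "measure_pmf.prob ?P (\<Union>x\<in>I. bad2 x) \<le> 4 ^ n * \<rho> powr (K * \<beta>)" .
  have "measure_pmf.prob ?P bad3 \<le> measure_pmf.expectation ?P (\<lambda>h. real (penalty h)) / \<theta>"
  proof -
    have "measure_pmf.prob ?P {h \<in> space ?P. \<theta> \<le> real (penalty h)}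
        \<le> measure_pmf.expectation ?P (\<lambda>h. real (penalty h)) / \<theta>"
      using \<theta> by (intro integral_Markov_inequality_measure[where A = "{}"]
          integrable_measure_pmf_finite finite_set_play_rounds[OF S]) auto
    then show ?thesis by (simp add: bad3_def)
  qed
  also have "\<dots> \<le> ((k * m + 1) * (n * (max s (k * m) * \<mu>)) + T * (s * \<mu>)) / \<theta>"
    using expectation_penalty_le[OF T(1) \<mu>] m \<theta> by (intro divide_right_mono) (auto simp: cc)
  finally have p3: "measure_pmf.prob ?P bad3 \<le> ((k * m + 1) * (n * (max s (k * m) * \<mu>)) + T * (s * \<mu>)) / \<theta>" .
  \<comment> \<open>Outside the bad events the win is deterministic: the free edges give stars and
    dense pairs, hence admissible tasks avoiding all of Breaker's edges, and the penalty fits the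
    budget.\<close>
  have good: "h \<in> {h. length h = T \<and> maker_wins n k h}"
    if h: "h \<in> set_pmf ?P" "h \<notin> (\<Union>v\<in>?V - C. bad1 v)" "h \<notin> (\<Union>x\<in>I. bad2 x)" "h \<notin> bad3" for h
  proof -
    let ?Z = "breaker_edges h"
    have hp: "play n b strat h" "length h = T"
      using set_play_rounds[OF S _ h(1)] T by auto
    have pen: "real (penalty h) < \<theta>" using h by (simp add: bad3_def)
    have star: "k \<le> card {c \<in> C. {v, c} \<notin> ?Z}" if "v \<in> ?V - C" for v
    proof -
      have disj: "{v} \<inter> C = {}" using that by auto
      have "card {v} * card C \<le> card (cross {v} C \<inter> ?Z) + (\<Sum>a\<in>{v}. card {u \<in> C. {a, u} \<notin> ?Z})"
        using disj by (intro card_cross_split) (auto simp: C_def)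
      then have "real (k + m) \<le> card (cross {v} C \<inter> ?Z) + card {u \<in> C. {v, u} \<notin> ?Z}"
        unfolding of_nat_add[symmetric] of_nat_le_iff by (simp add: C_def)
      moreover have "card (cross {v} C \<inter> ?Z) < (1 - \<alpha>) * (k + m)"
      proof -
        have "h \<notin> bad1 v" using h(2) that by blast
        then show ?thesis unfolding bad1_def card_cross[OF disj] by (simp add: C_def)
      qed
      ultimately have "\<alpha> * (k + m) < card {u \<in> C. {v, u} \<notin> ?Z}" by (simp add: algebra_simps)
      then show ?thesis using m by linarith
    qed
    have dense: "\<exists>a\<in>A. \<alpha> * card U \<le> card {u \<in> U. {a, u} \<notin> ?Z}"
      if AU: "A \<subseteq> ?V" "U \<subseteq> ?V" "A \<inter> U = {}" "card A = K" "\<beta> \<le> real (card U)" for A U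
    proof (rule ccontr)
      assume no: "\<not> ?thesis"
      have fin: "finite A" "finite U" using AU finite_subset by blast+
      have "card A * card U \<le> card (cross A U \<inter> ?Z) + (\<Sum>a\<in>A. card {u \<in> U. {a, u} \<notin> ?Z})"
        using AU fin by (intro card_cross_split) auto
      then have "real (card A * card U) \<le> card (cross A U \<inter> ?Z) + (\<Sum>a\<in>A. real (card {u \<in> U. {a, u} \<notin> ?Z}))"
        unfolding of_nat_sum[symmetric] of_nat_add[symmetric] of_nat_le_iff .
      moreover have "(\<Sum>a\<in>A. real (card {u \<in> U. {a, u} \<notin> ?Z})) \<le> (\<Sum>a\<in>A. \<alpha> * card U)"
        using no by (intro sum_mono) (auto simp: not_le less_imp_le)
      moreover have "card (cross A U \<inter> ?Z) < (1 - \<alpha>) * (card A * card U)"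
      proof -
        have "(A, U) \<in> I" using AU by (simp add: I_def)
        then have "h \<notin> bad2 (A, U)" using h(3) by blast
        then show ?thesis using card_cross[OF AU(3)] by (simp add: bad2_def)
      qed
      ultimately show False by (simp add: algebra_simps)
    qed
    have avail: "\<exists>P H. admissible Y P H \<and> H \<inter> ?Z = {}" if "Y \<subseteq> ?V - C" "Y \<noteq> {}" for Y
      by (rule admissible_exists[OF task_strategy_axioms k L s \<gamma> \<alpha> \<beta> _ star dense that])
        (use m in \<open>auto simp: C_def\<close>)
    have "maker_wins n k h"
    proof (rule task_strategy_wins[OF hp(1) avail])
      show "penalty h < n" using pen \<theta> by linarith
      have "real (card (?V - C)) \<le> n" using card_mono[of ?V "?V - C"] by auto
      then have "task_weight k \<gamma> n (card (?V - C)) \<le> (1 + \<gamma>) * (real k / 2) * n + real k * (\<gamma> * n)"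
        unfolding task_weight_def using \<gamma> by (intro add_mono mult_left_mono) auto
      moreover have "s * real (penalty h) \<le> s * \<theta>" using pen by (intro mult_left_mono) auto
      ultimately show "card core + task_weight k \<gamma> n (card (?V - C)) + s * penalty h + s < length h"
        using len hp cc by simp
      show "C \<subseteq> ?V" "k < n" using m by (auto simp: C_def)
      show "(c, d) \<in> (avoiding E X)\<^sup>*"
        if "core \<subseteq> E" "finite X" "card X < k" "c \<in> C - X" "d \<in> C - X" for X c d E
        using that m unfolding CD core_def
        by (intro cross_connected_avoiding[of D R k]) (auto simp: D_def R_def)
    qed auto
    then show ?thesis using hp by simp
  qed
  let ?G = "{h. length h = T \<and> maker_wins n k h}"
  let ?B = "(\<Union>v\<in>?V - C. bad1 v) \<union> (\<Union>x\<in>I. bad2 x) \<union> bad3"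
  have "1 = measure_pmf.prob ?P (set_pmf ?P)" by (simp add: measure_pmf.prob_eq_1 AE_measure_pmf_iff)
  also have "\<dots> \<le> measure_pmf.prob ?P (?G \<union> ?B)"
    using good by (intro measure_pmf.finite_measure_mono) auto
  also have "\<dots> \<le> measure_pmf.prob ?P ?G + measure_pmf.prob ?P ?B"
    by (intro measure_Un_le) auto
  also have "measure_pmf.prob ?P ?B \<le> measure_pmf.prob ?P (\<Union>v\<in>?V - C. bad1 v) +
      measure_pmf.prob ?P (\<Union>x\<in>I. bad2 x) + measure_pmf.prob ?P bad3"
    by (intro order_trans[OF measure_Un_le] add_mono measure_Un_le order_refl) auto
  finally show ?thesis using p1 p2 p3 S by (intro exI[of _ strat]) linarith
qed

section \<open>From \<open>T\<close> rounds to the whole game\<close>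

lemma prob_play_rounds_mono:
  assumes S: "maker_strategy n S" and closed: "\<And>h x. h \<in> E \<Longrightarrow> h @ [x] \<in> E" and "t \<le> t'"
  shows "measure_pmf.prob (play_rounds n b S t) E \<le> measure_pmf.prob (play_rounds n b S t') E"
  using \<open>t \<le> t'\<close>
proof (induction rule: dec_induct)
  case (step t)
  let ?P = "play_rounds n b S t"
  let ?f = "\<lambda>h. if unclaimed n h = {} then return_pmf h else play_round n b S h"
  have "measure_pmf.prob ?P E = (\<Sum>h\<in>set_pmf ?P. pmf ?P h *\<^sub>R indicator E h)"
  proof -
    have "measure_pmf.prob ?P E = measure_pmf.expectation ?P (indicator E)" by simp
    also have "\<dots> = (\<Sum>h\<in>set_pmf ?P. pmf ?P h *\<^sub>R indicator E h)"
      by (rule integral_measure_pmf[OF finite_set_play_rounds[OF S]])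
    finally show ?thesis .
  qed
  also have "\<dots> \<le> (\<Sum>h\<in>set_pmf ?P. pmf ?P h *\<^sub>R measure_pmf.expectation (?f h) (indicator E))"
  proof (intro sum_mono scaleR_left_mono)
    fix h
    \<comment> \<open>A further round either keeps the history or appends one entry, so it cannot
      leave \<open>E\<close>.\<close>
    have "measure_pmf.prob (?f h) E = 1" if "h \<in> E"
      using that closed by (auto simp: measure_pmf.prob_eq_1 AE_measure_pmf_iff play_round_def)
    then have "indicat_real E h \<le> measure_pmf.prob (?f h) E" by (cases "h \<in> E") auto
    then show "indicat_real E h \<le> measure_pmf.expectation (?f h) (indicator E)" by simp
  qed auto
  also have "\<dots> = measure_pmf.expectation (play_rounds n b S (Suc t)) (indicator E)"
    unfolding play_rounds.simps
    by (rule pmf_expectation_bind[symmetric, OF finite_set_play_rounds[OF S] _ subset_refl])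
      (simp add: finite_set_play_round[OF S])
  finally show ?case using step by simp
qed simp

lemma maker_wins_append: "maker_wins n k h \<Longrightarrow> maker_wins n k (h @ h')"
proof -
  assume h: "maker_wins n k h"
  have sub: "maker_edges h \<subseteq> maker_edges (h @ h')" by (auto simp: maker_edges_def)
  have "{(x, y). x \<in> W \<and> y \<in> W \<and> {x, y} \<in> maker_edges h}\<^sup>* \<subseteq>
    {(x, y). x \<in> W \<and> y \<in> W \<and> {x, y} \<in> maker_edges (h @ h')}\<^sup>*" for W
    by (rule rtrancl_mono) (use sub in auto)
  then show ?thesis using h
    unfolding maker_wins_def vertex_connected_def graph_connected_def by blast
qed

text \<open>A win persists because Maker's graph only grows, and the prefix that witnesses its time
  stays a prefix.\<close>

lemma random_breaker_game_ge:
  assumes S: "maker_strategy n S" and T: "T \<le> n choose 2" "real T \<le> r"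
  shows "measure_pmf.prob (play_rounds n b S T) {h. length h = T \<and> maker_wins n k h}
    \<le> measure_pmf.prob (random_breaker_game n b S) {h. maker_wins n k h \<and> maker_wins_within n k r h}"
proof -
  let ?E = "{h. maker_wins n k h \<and> maker_wins_within n k r h}"
  have "measure_pmf.prob (play_rounds n b S T) {h. length h = T \<and> maker_wins n k h}
      \<le> measure_pmf.prob (play_rounds n b S T) ?E"
    using T by (intro measure_pmf.finite_measure_mono) (auto simp: maker_wins_within_def)
  also have "\<dots> \<le> measure_pmf.prob (play_rounds n b S (n choose 2)) ?E"
  proof (rule prob_play_rounds_mono[OF S _ T(1)])
    fix h x assume "h \<in> ?E"
    then obtain t where h: "maker_wins n k h" and t: "t \<le> length h" "real t \<le> r" "maker_wins n k (take t h)"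
      by (auto simp: maker_wins_within_def)
    have "maker_wins_within n k r (h @ [x])"
      unfolding maker_wins_within_def using t by (intro exI[of _ t]) auto
    then show "h @ [x] \<in> ?E" using maker_wins_append[OF h] by blast
  qed
  finally show ?thesis by (simp add: random_breaker_game_def)
qed

section \<open>Asymptotics\<close>

lemma real_choose_two: "real (n choose 2) = real n * (real n - 1) / 2"
proof (cases n)
  case (Suc m)
  have "even (n * (n - 1))" by auto
  then show ?thesis using Suc by (simp add: choose_two real_of_nat_div algebra_simps)
qed simp

text \<open>\<open>J n\<close> is the largest suitable index; the bound \<open>j \<le> n\<close>
  ensures that it exists, and every fixed index is eventually suitable, so \<open>J\<close> is
  unbounded.\<close>

lemma diagonal_sequence:
  fixes Q :: "nat \<Rightarrow> nat \<Rightarrow> bool"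
  assumes "\<And>j. eventually (\<lambda>n. Q j n) sequentially"
  obtains J where "filterlim J at_top sequentially" "\<And>n. J n = 0 \<or> Q (J n) n"
proof -
  define J where "J n = (GREATEST j. j \<le> n \<and> (j = 0 \<or> Q j n))" for n
  have ex: "J n \<le> n \<and> (J n = 0 \<or> Q (J n) n)" for n
    unfolding J_def by (rule GreatestI_nat[of _ 0 n]) auto
  have ge: "j \<le> J n" if "j \<le> n" "Q j n" for j n
    unfolding J_def by (rule Greatest_le_nat[of _ _ n]) (use that in auto)
  have "eventually (\<lambda>n. j \<le> J n) sequentially" for j
    using assms[of j] eventually_ge_at_top[of j] by eventually_elim (rule ge)
  then have "filterlim J at_top sequentially" by (simp add: filterlim_at_top)
  then show ?thesis using that ex by blast
qed

lemma ex_maker_strategy: "\<exists>S. maker_strategy n S"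
proof -
  have "maker_strategy n (\<lambda>h B. SOME e. e \<in> unclaimed n h - B)"
    unfolding maker_strategy_def by (simp only: some_in_eq) simp
  then show ?thesis by (rule exI[of "maker_strategy n"])
qed

text \<open>The parameters are fixed in the order \<alpha>, \<gamma>, \<open>L\<close>,
  \<open>s\<close>, \<open>K\<close>, \<kappa>; only \<open>T\<close>, \<open>m\<close> and \<mu>
  vary with \<open>n\<close>. The three error terms then tend to 0.\<close>

lemma eventually_maker_wins:
  fixes \<epsilon> \<delta> \<eta> :: real and k :: nat and b :: "nat \<Rightarrow> nat"
  assumes \<epsilon>: "0 < \<epsilon>" "\<epsilon> \<le> 1" and k: "k \<ge> 2" and b: "\<And>n. real (b n) \<le> (1 - \<epsilon>) * (real n / real k)"
    and \<delta>: "0 < \<delta>" "\<delta> \<le> \<epsilon> / 2" and \<eta>: "0 < \<eta>"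
  shows "eventually (\<lambda>n. \<exists>S. maker_strategy n S \<and>
     1 - \<eta> \<le> measure_pmf.prob (random_breaker_game n (b n) S)
       {h. maker_wins n k h \<and> maker_wins_within n k ((1 + \<delta>) * (real k * real n / 2)) h}) sequentially"
proof -
  \<comment> \<open>The share of the board claimed in \<open>T n\<close> rounds is about
    \<open>(1 + \<delta>) * (1 - \<epsilon>)\<close>, which is below
    \<open>1 - \<epsilon> / 2\<close>.\<close>
  define q where "q = 1 - \<epsilon> / 2"
  have e4: "0 < 1 - \<epsilon> / 4" "1 - \<epsilon> / 4 < 1" using \<epsilon> by auto
  \<comment> \<open>Half the logarithm ensures
    \<open>\<rho> = (1 - \<epsilon> / 4) * 2 powr \<alpha> < 1\<close>.\<close>
  define \<alpha> where "\<alpha> = min 1 (log 2 (1 / (1 - \<epsilon> / 4)) / 2)"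
  have lg: "0 < log 2 (1 / (1 - \<epsilon> / 4))" using e4 by (simp add: log_divide zero_less_log_cancel_iff)
  then have \<alpha>: "0 < \<alpha>" "\<alpha> \<le> 1" "\<alpha> < log 2 (1 / (1 - \<epsilon> / 4))" unfolding \<alpha>_def by linarith+
  define \<rho> where "\<rho> = (1 + q) / 2 powr (1 - \<alpha>)"
  have "2 powr \<alpha> < 1 / (1 - \<epsilon> / 4)" using \<alpha>(3) e4 by (subst less_log_iff[symmetric]) auto
  then have "(1 - \<epsilon> / 4) * 2 powr \<alpha> < 1" using e4 by (simp add: field_simps)
  moreover have "\<rho> = (1 - \<epsilon> / 4) * 2 powr \<alpha>"
    unfolding \<rho>_def q_def powr_diff by (simp add: field_simps)
  ultimately have \<rho>: "0 < \<rho>" "\<rho> < 1" using e4 by simp_all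
  define \<gamma> where "\<gamma> = \<delta> / 8"
  have \<gamma>: "0 < \<gamma>" using \<delta> by (simp add: \<gamma>_def)
  define L where "L = nat \<lceil>2 * k / \<gamma>\<rceil>"
  have Lge: "2 * k / \<gamma> \<le> L" unfolding L_def by (rule real_nat_ceiling_ge)
  then have L2: "2 * k \<le> \<gamma> * L" using \<gamma> by (simp add: field_simps)
  then have L: "1 \<le> L" using k by (cases L) auto
  define s where "s = k * L + 2 * k * k"
  have "k * 1 \<le> k * (2 * k)" using k by (intro mult_left_mono) auto
  then have "k \<le> s" unfolding s_def by linarith
  then have s: "0 < real s" "real k \<le> real s" using k by auto
  define \<gamma>' where "\<gamma>' = \<alpha> ^ L * \<gamma> / 2"
  have \<gamma>': "0 < \<gamma>'" using \<alpha> \<gamma> by (simp add: \<gamma>'_def)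
  have "\<rho> powr \<gamma>' < 1" using \<rho> \<gamma>' powr_less_mono2[of \<gamma>' \<rho> 1] by simp
  \<comment> \<open>With \<open>\<beta> = \<gamma>' * n\<close> the second error term becomes at
    most \<open>4 ^ n * (1 / 8) ^ n\<close>.\<close>
  then obtain K where "(\<rho> powr \<gamma>') ^ K < 1 / 8" using real_arch_pow_inv[of "1 / 8" "\<rho> powr \<gamma>'"] by auto
  then have K: "\<rho> powr (K * \<gamma>') < 1 / 8" using \<rho> by (simp add: powr_realpow[symmetric] powr_powr mult.commute)
  \<comment> \<open>The tolerated penalty \<open>\<kappa> * n\<close> costs
    \<open>s * \<kappa> * n = \<delta> * k * n / 16\<close> rounds, a small part of the
    slack.\<close>
  define \<kappa> where "\<kappa> = \<delta> * k / (16 * s)"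
  have \<kappa>: "0 < \<kappa>" "\<kappa> \<le> 1" "s * \<kappa> = \<delta> * k / 16"
  proof -
    have "\<delta> * k \<le> 16 * real s" using \<delta> \<epsilon> s by (intro mult_mono) auto
    then show "0 < \<kappa>" "\<kappa> \<le> 1" "s * \<kappa> = \<delta> * k / 16" using \<delta> k s(1) by (simp_all add: \<kappa>_def)
  qed
  define T where "T n = nat \<lfloor>(1 + \<delta>) * (real k * real n / 2)\<rfloor>" for n
  have T_le: "real (T n) \<le> (1 + \<delta>) * (real k * real n / 2)" for n
    using \<delta> unfolding T_def by (intro of_nat_floor) auto
  have T_ge: "(1 + \<delta>) * (real k * real n / 2) - 1 \<le> real (T n)" for n
    unfolding T_def by linarith
  \<comment> \<open>Large enough that \<open>n * \<rho> ^ m\<close> vanishes, small enough that the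
    square of the core size is \<open>o(n)\<close>, which makes spoiling the core unlikely.\<close>
  define m where "m n = nat \<lceil>real n powr (1 / 4)\<rceil>" for n
  have m_ge: "real n powr (1 / 4) \<le> m n" for n unfolding m_def by (rule real_nat_ceiling_ge)
  have m_le: "m n \<le> real n powr (1 / 4) + 1" for n
  proof -
    have "(0 :: int) \<le> \<lceil>real n powr (1 / 4)\<rceil>" by (simp add: less_le_trans[of _ 0])
    then show ?thesis unfolding m_def by (simp add: of_int_ceiling_le_add_one)
  qed
  \<comment> \<open>Here \<open>b \<le> n\<close>, and at least
    \<open>\<epsilon> / 2 * (n ^ 2 / 4)\<close> edges are unclaimed throughout the first
    \<open>T n\<close> rounds.\<close>
  define \<mu> where "\<mu> n = 8 / (\<epsilon> * real n)" for n
  define err where "err n = real n * \<rho> powr (real n powr (1 / 4)) + (1 / 2) ^ n +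
     (8 / \<epsilon> / \<kappa>) * ((k * (real n powr (1 / 4) + 1) + 1) * (s + k * (real n powr (1 / 4) + 1)) + k * s) / n" for n
  have "err \<longlonglongrightarrow> 0"
    unfolding err_def using \<rho> by real_asymp
  then have ev_err: "eventually (\<lambda>n. err n < \<eta>) sequentially" using \<eta> by (rule order_tendstoD)
  have ev1: "eventually (\<lambda>n. real k \<le> real n powr (1 / 4)) sequentially" by real_asymp
  have ev2: "eventually (\<lambda>n. k + (real n powr (1 / 4) + 1) < n) sequentially" by real_asymp
  have ev3: "eventually (\<lambda>n. k \<le> \<alpha> * (k + real n powr (1 / 4))) sequentially" using \<alpha> by real_asymp
  have ev4: "eventually (\<lambda>n. real L \<le> \<gamma>' * n) sequentially" using \<gamma>' by real_asymp
  have ev5: "eventually (\<lambda>n. real (K + L) \<le> \<gamma> / 2 * n) sequentially" using \<gamma> by real_asymp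
  have ev6: "eventually (\<lambda>n. k * (real n powr (1 / 4) + 1) + s + 1 < \<delta> * k / 8 * n) sequentially"
    using \<delta> k by real_asymp
  have ev7: "eventually (\<lambda>n. 2 * real k * n + real n \<le> \<epsilon>\<^sup>2 / 2 * real n ^ 2) sequentially"
    using \<epsilon> by real_asymp
  show ?thesis
    using ev_err ev1 ev2 ev3 ev4 ev5 ev6 ev7 eventually_ge_at_top[of 2]
  proof eventually_elim
    case (elim n)
    have n: "2 \<le> n" by fact
    let ?b = "b n" and ?T = "T n" and ?m = "m n" and ?N = "real (n choose 2)"
    have N: "?N = real n * (real n - 1) / 2" by (rule real_choose_two)
    have TN: "real (?T * (?b + 1)) \<le> q * ?N"
    proof -
      have "real (?T * (?b + 1)) \<le> (1 + \<delta>) * (real k * real n / 2) * ((1 - \<epsilon>) * (real n / real k) + 1)"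
        unfolding of_nat_mult using T_le[of n] b[of n] by (intro mult_mono) auto
      also have "\<dots> = (1 + \<delta>) * (1 - \<epsilon>) * (real n ^ 2 / 2) + (1 + \<delta>) * (real k * real n / 2)"
        using k by (simp add: field_simps power2_eq_square)
      \<comment> \<open>As \<open>\<delta> \<le> \<epsilon> / 2\<close>, a surplus of order
        \<open>\<epsilon>\<^sup>2 * n ^ 2\<close> remains to absorb the linear terms.\<close>
      also have "\<dots> \<le> (1 - \<epsilon> / 2 - \<epsilon>\<^sup>2 / 2) * (real n ^ 2 / 2) + 2 * (real k * real n / 2)"
      proof (intro add_mono mult_right_mono)
        have "(1 + \<delta>) * (1 - \<epsilon>) \<le> (1 + \<epsilon> / 2) * (1 - \<epsilon>)" using \<delta> \<epsilon> by (intro mult_right_mono) auto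
        then show "(1 + \<delta>) * (1 - \<epsilon>) \<le> 1 - \<epsilon> / 2 - \<epsilon>\<^sup>2 / 2" by (simp add: field_simps power2_eq_square)
        show "1 + \<delta> \<le> 2" using \<delta> \<epsilon> by linarith
      qed auto
      also have "\<dots> \<le> (1 - \<epsilon> / 2) * (real n ^ 2 / 2) - real n / 2"
        using elim(8) by (simp add: algebra_simps)
      also have "\<dots> \<le> q * ?N"
        unfolding N q_def using \<epsilon> by (simp add: field_simps power2_eq_square)
      finally show ?thesis .
    qed
    have Npos: "0 < ?N" "real n ^ 2 / 4 \<le> ?N"
    proof -
      have "real n * 2 \<le> real n * real n" using n by (intro mult_left_mono) auto
      then show "real n ^ 2 / 4 \<le> ?N" unfolding N by (simp add: field_simps power2_eq_square)
      moreover have "0 < real n ^ 2 / 4" using n by simp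
      ultimately show "0 < ?N" by linarith
    qed
    have "q * ?N < 1 * ?N" using Npos \<epsilon> by (intro mult_strict_right_mono) (auto simp: q_def)
    then have "real (?T * (?b + 1)) < ?N" using TN by linarith
    then have TN': "?T * (?b + 1) < n choose 2" by (simp only: of_nat_less_iff)
    have \<mu>b: "real ?b \<le> \<mu> n * (?N - real (?T * (?b + 1)))"
    proof -
      have "real ?b \<le> 1 * (real n / 1)"
      proof -
        have "(1 - \<epsilon>) * (real n / real k) \<le> 1 * (real n / 1)"
          using \<epsilon> k by (intro mult_mono divide_left_mono) auto
        then show ?thesis using b[of n] by linarith
      qed
      also have "\<dots> = \<mu> n * (\<epsilon> / 2 * (real n ^ 2 / 4))"
        using n \<epsilon> by (simp add: \<mu>_def power2_eq_square)
      also have "\<dots> \<le> \<mu> n * (\<epsilon> / 2 * ?N)"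
        using Npos \<epsilon> by (intro mult_left_mono) (auto simp: \<mu>_def)
      also have "\<epsilon> / 2 * ?N = ?N - q * ?N" by (simp add: q_def algebra_simps)
      also have "\<mu> n * (?N - q * ?N) \<le> \<mu> n * (?N - real (?T * (?b + 1)))"
        using TN \<epsilon> by (intro mult_left_mono) (auto simp: \<mu>_def)
      finally show ?thesis .
    qed
    have "\<exists>S. maker_strategy n S \<and>
      1 - (n * \<rho> ^ (k + ?m) + 4 ^ n * \<rho> powr (K * (\<gamma>' * n)) +
         ((k * ?m + 1) * (n * (max s (k * ?m) * \<mu> n)) + ?T * (s * \<mu> n)) / (\<kappa> * n))
      \<le> measure_pmf.prob (play_rounds n ?b S ?T) {h. length h = ?T \<and> maker_wins n k h}"
    proof (rule prob_maker_wins_ge[OF k L L2 s_def \<gamma> \<alpha>(1,2) elim(5) _ _ _ _ TN' TN \<rho>_def \<rho> \<mu>b])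
      have "\<gamma>' * n = \<alpha> ^ L * (\<gamma> / 2 * n)" by (simp add: \<gamma>'_def)
      also have "\<dots> \<le> \<alpha> ^ L * (\<gamma> * n - (K + L))" using elim(6) \<alpha> by (intro mult_left_mono) auto
      finally show "\<gamma>' * n \<le> \<alpha> ^ L * (\<gamma> * n - (K + L))" .
      show "k \<le> ?m" using elim(2) m_ge[of n] by linarith
      have "real (k + ?m) < real n" using elim(3) m_le[of n] by simp
      then show "k + ?m < n" by (simp only: of_nat_less_iff)
      have "\<alpha> * (k + real n powr (1 / 4)) \<le> \<alpha> * (k + ?m)" using m_ge[of n] \<alpha> by (intro mult_left_mono) auto
      then show "k \<le> \<alpha> * (k + ?m)" using elim(4) by linarith
      show "0 \<le> \<mu> n" "0 < \<kappa> * n" "\<kappa> * n \<le> n" using \<epsilon> \<kappa> n by (auto simp: \<mu>_def)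
      have "real k * ?m \<le> k * (real n powr (1 / 4) + 1)" using m_le[of n] by (intro mult_left_mono) auto
      then have "real (k * ?m) + s + 1 < 2 * (\<delta> * k / 16 * n)" using elim(7) by simp
      moreover have "s * (\<kappa> * n) = \<delta> * k / 16 * n" using \<kappa>(3) by (metis mult.assoc)
      \<comment> \<open>With \<open>\<gamma> = \<delta> / 8\<close> five units of
        \<open>\<delta> * k * n / 16\<close> are left over: one for penalties, fewer than two for
        the core, \<open>s\<close> and rounding.\<close>
      moreover have "(1 + \<gamma>) * (real k / 2) * n + real k * (\<gamma> * n) = (1 + \<delta>) * (real k * real n / 2) - 5 * (\<delta> * k / 16 * n)"
        by (simp add: \<gamma>_def field_simps)
      moreover have "0 \<le> \<delta> * k / 16 * n" using \<delta> by simp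
      ultimately show "real (k * ?m) + ((1 + \<gamma>) * (real k / 2) * n + real k * (\<gamma> * n)) + s * (\<kappa> * n) + s < ?T"
        using T_ge[of n] by linarith
    qed
    then obtain S where S: "maker_strategy n S"
      and pr: "1 - (n * \<rho> ^ (k + ?m) + 4 ^ n * \<rho> powr (K * (\<gamma>' * n)) +
         ((k * ?m + 1) * (n * (max s (k * ?m) * \<mu> n)) + ?T * (s * \<mu> n)) / (\<kappa> * n))
      \<le> measure_pmf.prob (play_rounds n ?b S ?T) {h. length h = ?T \<and> maker_wins n k h}" by blast
    have e1: "n * \<rho> ^ (k + ?m) \<le> n * \<rho> powr (real n powr (1 / 4))"
    proof (intro mult_left_mono)
      have "\<rho> ^ (k + ?m) = \<rho> powr (k + ?m)" using \<rho> by (subst powr_realpow) auto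
      also have "\<dots> \<le> \<rho> powr (real n powr (1 / 4))" using \<rho> m_ge[of n] by (intro powr_mono') auto
      finally show "\<rho> ^ (k + ?m) \<le> \<rho> powr (real n powr (1 / 4))" .
    qed auto
    have e2: "4 ^ n * \<rho> powr (K * (\<gamma>' * n)) \<le> (1 / 2) ^ n"
    proof -
      have "\<rho> powr (K * (\<gamma>' * n)) = (\<rho> powr (K * \<gamma>')) ^ n"
        using \<rho> by (simp add: powr_realpow[symmetric] powr_powr mult.assoc)
      also have "\<dots> \<le> (1 / 8) ^ n" using K by (intro power_mono) auto
      finally have "4 ^ n * \<rho> powr (K * (\<gamma>' * n)) \<le> 4 ^ n * (1 / 8) ^ n" by (intro mult_left_mono) auto
      also have "\<dots> = (1 / 2) ^ n" by (simp add: power_mult_distrib[symmetric])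
      finally show ?thesis .
    qed
    have e3: "((k * ?m + 1) * (n * (max s (k * ?m) * \<mu> n)) + ?T * (s * \<mu> n)) / (\<kappa> * n)
      \<le> (8 / \<epsilon> / \<kappa>) * ((k * (real n powr (1 / 4) + 1) + 1) * (s + k * (real n powr (1 / 4) + 1)) + k * s) / n"
    proof -
      let ?x = "real n powr (1 / 4) + 1"
      have km: "real (k * ?m) \<le> k * ?x" unfolding of_nat_mult using m_le[of n] by (intro mult_left_mono) auto
      have "max s (k * ?m) \<le> s + k * ?m" by simp
      then have mx: "real (max s (k * ?m)) \<le> s + k * ?x" using km by linarith
      have "real (k * ?m + 1) * real (max s (k * ?m)) \<le> (k * ?x + 1) * (s + k * ?x)"
        using km mx by (intro mult_mono) auto
      moreover have "real ?T * s / n \<le> k * s"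
      proof -
        have "(1 + \<delta>) * (real k * real n / 2) \<le> 2 * (real k * real n / 2)"
          using \<delta> \<epsilon> by (intro mult_right_mono) auto
        then have "real ?T \<le> real k * n" using T_le[of n] by linarith
        then have "real ?T * s \<le> real k * n * s" by (intro mult_right_mono) auto
        then show ?thesis using n by (simp add: field_simps)
      qed
      ultimately have "real (k * ?m + 1) * real (max s (k * ?m)) + real ?T * s / n \<le> (k * ?x + 1) * (s + k * ?x) + k * s"
        by linarith
      then have "(8 / \<epsilon> / \<kappa> / n) * (real (k * ?m + 1) * real (max s (k * ?m)) + real ?T * s / n)
          \<le> (8 / \<epsilon> / \<kappa> / n) * ((k * ?x + 1) * (s + k * ?x) + k * s)"
        using \<epsilon> \<kappa> by (intro mult_left_mono) auto
      moreover have "((k * ?m + 1) * (n * (max s (k * ?m) * \<mu> n)) + ?T * (s * \<mu> n)) / (\<kappa> * n) =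
          (8 / \<epsilon> / \<kappa> / n) * (real (k * ?m + 1) * real (max s (k * ?m)) + real ?T * s / n)"
        using n \<epsilon> \<kappa>(1) by (simp add: \<mu>_def field_simps)
      ultimately show ?thesis using n by simp
    qed
    have "1 - \<eta> \<le> measure_pmf.prob (play_rounds n ?b S ?T) {h. length h = ?T \<and> maker_wins n k h}"
      using pr e1 e2 e3 elim(1) unfolding err_def by linarith
    also have "\<dots> \<le> measure_pmf.prob (random_breaker_game n ?b S)
       {h. maker_wins n k h \<and> maker_wins_within n k ((1 + \<delta>) * (real k * real n / 2)) h}"
    proof (rule random_breaker_game_ge[OF S _ T_le])
      have "?T * 1 \<le> ?T * (?b + 1)" by (intro mult_left_mono) auto
      then show "?T \<le> n choose 2" using TN' by linarith
    qed
    finally show ?case using S by blast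
  qed
qed

theorem theorem1p3:
  fixes \<epsilon> :: real and k :: nat and b :: "nat \<Rightarrow> nat"
  assumes "\<epsilon> > 0"
    and "k \<ge> 2"
    and "\<And>n. real (b n) \<le> (1 - \<epsilon>) * (real n / real k)"
  shows "\<exists>(S :: nat \<Rightarrow> strategy) (\<delta> :: nat \<Rightarrow> real).
      (\<forall>n. maker_strategy n (S n)) \<and> \<delta> \<longlonglongrightarrow> 0 \<and>
      (\<lambda>n. measure_pmf.prob (random_breaker_game n (b n) (S n))
         {h. maker_wins n k h \<and>
             maker_wins_within n k ((1 + \<delta> n) * (real k * real n / 2)) h})
        \<longlonglongrightarrow> 1"
proof -
  \<comment> \<open>The bias bound at \<open>n = 1\<close> already forces
    \<open>\<epsilon> \<le> 1\<close>, because \<open>b 1\<close> is nonnegative.\<close>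
  have "0 \<le> (1 - \<epsilon>) * (1 / real k)" using assms(3)[of 1] by (metis of_nat_0_le_iff of_nat_1 order_trans)
  then have \<epsilon>1: "\<epsilon> \<le> 1" using assms(2) by (simp add: zero_le_divide_iff)
  define d where "d j = 1 / (real j + 1)" for j
  \<comment> \<open>The minimum respects the restriction
    \<open>\<delta> \<le> \<epsilon> / 2\<close> of \<open>eventually_maker_wins\<close> and still
    tends to 0.\<close>
  define e where "e j = min (d j) (\<epsilon> / 2)" for j
  define W where "W n r = {h. maker_wins n k h \<and> maker_wins_within n k ((1 + r) * (real k * real n / 2)) h}" for n r
  define Q where "Q j n \<longleftrightarrow> (\<exists>S. maker_strategy n S \<and>
     1 - d j \<le> measure_pmf.prob (random_breaker_game n (b n) S) (W n (e j)))" for j n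
  have "eventually (\<lambda>n. Q j n) sequentially" for j
    unfolding Q_def W_def using assms \<epsilon>1
    by (intro eventually_maker_wins) (auto simp: d_def e_def)
  then obtain J where J: "filterlim J at_top sequentially" and JQ: "\<And>n. J n = 0 \<or> Q (J n) n"
    using diagonal_sequence[of Q] by blast
  \<comment> \<open>For the finitely many \<open>n\<close> with \<open>J n = 0\<close> any legal
    strategy will do.\<close>
  have "\<forall>n. \<exists>S. maker_strategy n S \<and> (J n \<noteq> 0 \<longrightarrow>
     1 - d (J n) \<le> measure_pmf.prob (random_breaker_game n (b n) S) (W n (e (J n))))"
    using JQ ex_maker_strategy unfolding Q_def by metis
  then obtain S where S: "\<And>n. maker_strategy n (S n)"
    and pr: "\<And>n. J n \<noteq> 0 \<Longrightarrow> 1 - d (J n) \<le> measure_pmf.prob (random_breaker_game n (b n) (S n)) (W n (e (J n)))"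
    by metis
  have d0: "(\<lambda>n. d (J n)) \<longlonglongrightarrow> 0"
  proof -
    have "d \<longlonglongrightarrow> 0" unfolding d_def by real_asymp
    then show ?thesis using J by (rule filterlim_compose)
  qed
  have e0: "(\<lambda>n. e (J n)) \<longlonglongrightarrow> 0"
    using assms(1) by (intro tendsto_sandwich[OF _ _ tendsto_const d0])
      (auto simp: e_def d_def intro!: always_eventually)
  have "(\<lambda>n. measure_pmf.prob (random_breaker_game n (b n) (S n)) (W n (e (J n)))) \<longlonglongrightarrow> 1"
  proof (rule tendsto_sandwich)
    show "(\<lambda>n. 1 - d (J n)) \<longlonglongrightarrow> 1" using tendsto_diff[OF tendsto_const d0, of 1] by simp
    have "eventually (\<lambda>n. 1 \<le> J n) sequentially" using J by (simp add: filterlim_at_top)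
    then show "eventually (\<lambda>n. 1 - d (J n) \<le> measure_pmf.prob (random_breaker_game n (b n) (S n)) (W n (e (J n)))) sequentially"
      by eventually_elim (rule pr, simp)
  qed auto
  then show ?thesis using S e0 unfolding W_def by (intro exI[of _ S] exI[of _ "\<lambda>n. e (J n)"]) auto
qed

end
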